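(* Let $a,\sigma>0$ and $\theta\ge 0$ be constants, and let $\nu$ be a Lévy measure concentrated on $(0,\infty)$ with $\int_{(0,\infty)}(\xi\wedge 1)\,\nu(d\xi)<\infty$. For $x\ge 0$ let $(X^x_t)_{t\ge 0}$ be the jump-diffusion CIR (JCIR) process started from $x$, i.e. the unique strong solution of $$dX^x_t=a(\theta-X^x_t)\,dt+\sigma\sqrt{X^x_t}\,dW_t+dJ_t,\qquad X^x_0=x,$$ where $W$ is a one-dimensional Brownian motion and $J$ is an independent pure-jump Lévy process with Lévy measure $\nu$. Suppose that $\int_{(1,\infty)}\xi\,\nu(d\xi)<\infty$. Then the function $V(x)=x$, $x\ge0$, is a Forster-Lyapunov function for the JCIR process, in the sense that there is a constant $0<M<\infty$ (independent of $t$ and $x$) such that for all $t>0$ and $x\ge0$, $$E[V(X^x_t)]\le e^{-at}V(x)+M .$$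
   Context: All processes live on a filtered probability space $(\Omega,\mathcal F,(\mathcal F_t)_{t\ge0},P)$. The pure-jump Lévy process $J$ has only positive jumps, no drift and no Gaussian part, i.e. $E[e^{uJ_t}]=\exp\big(t\int_{(0,\infty)}(e^{u\xi}-1)\nu(d\xi)\big)$ for $\Re u\le 0$. The stochastic differential equation has a unique strong solution, which stays in $\mathbb{R}_+=[0,\infty)$. Its law is characterized by $$E[e^{uX^x_t}]=\Big(1-\tfrac{\sigma^2}{2a}u(1-e^{-at})\Big)^{-2a\theta/\sigma^2}\exp\big(x\psi(t,u)\big)\exp\Big(\int_0^t\int_{(0,\infty)}\big(e^{\xi\psi(s,u)}-1\big)\nu(d\xi)\,ds\Big),\quad \Re u\le0,$$ with $\psi(t,u)=\dfrac{ue^{-at}}{1-\frac{\sigma^2}{2a}u(1-e^{-at})}$ (principal branch of the power). *)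

theory Defs
  imports "HOL-Probability.Probability"
begin

section \<open>Processes on a filtered probability space\<close>

text \<open>
  Processes are functions \<open>Y :: real \<Rightarrow> 'w \<Rightarrow> real\<close> (time, then outcome); only their values at
  times \<open>t \<ge> 0\<close> are ever used. The library locale \<open>filtration\<close> indexes by all of \<open>real\<close>; a
  filtration on the half line is extended by \<open>F t = F 0\<close> for \<open>t < 0\<close>. Completeness and
  right-continuity of the filtration are not required.
\<close>

definition filtered_prob_space :: "'w measure \<Rightarrow> (real \<Rightarrow> 'w measure) \<Rightarrow> bool" where
  "filtered_prob_space P F \<longleftrightarrow>
     prob_space P \<and> filtration (space P) F \<and> (\<forall>t. sets (F t) \<subseteq> sets P)"

definition adapted :: "(real \<Rightarrow> 'w measure) \<Rightarrow> (real \<Rightarrow> 'w \<Rightarrow> real) \<Rightarrow> bool" where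
  "adapted F Y \<longleftrightarrow> (\<forall>t\<ge>0. Y t \<in> borel_measurable (F t))"

definition progressively_measurable ::
  "(real \<Rightarrow> 'w measure) \<Rightarrow> (real \<Rightarrow> 'w \<Rightarrow> real) \<Rightarrow> bool" where
  "progressively_measurable F Y \<longleftrightarrow>
     (\<forall>T\<ge>0. (\<lambda>(s, \<omega>). Y s \<omega>) \<in> borel_measurable (restrict_space borel {0..T} \<Otimes>\<^sub>M F T))"

definition cadlag :: "(real \<Rightarrow> real) \<Rightarrow> bool" where
  "cadlag f \<longleftrightarrow>
     (\<forall>t\<ge>0. (f \<longlongrightarrow> f t) (at_right t)) \<and> (\<forall>t>0. \<exists>l. (f \<longlongrightarrow> l) (at_left t))"

definition indep_increments_wrt ::
  "'w measure \<Rightarrow> (real \<Rightarrow> 'w measure) \<Rightarrow> (real \<Rightarrow> 'w \<Rightarrow> real) \<Rightarrow> bool" where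
  "indep_increments_wrt P F Y \<longleftrightarrow>
     (\<forall>s t. 0 \<le> s \<and> s < t \<longrightarrow>
        prob_space.indep_set P (sets (F s))
          (sets (vimage_algebra (space P) (\<lambda>\<omega>. Y t \<omega> - Y s \<omega>) borel)))"

definition process_algebra :: "'w measure \<Rightarrow> (real \<Rightarrow> 'w \<Rightarrow> real) \<Rightarrow> 'w set set" where
  "process_algebra P Y =
     sigma_sets (space P) (\<Union>t\<in>{0..}. sets (vimage_algebra (space P) (Y t) borel))"

definition independent_processes ::
  "'w measure \<Rightarrow> (real \<Rightarrow> 'w \<Rightarrow> real) \<Rightarrow> (real \<Rightarrow> 'w \<Rightarrow> real) \<Rightarrow> bool" where
  "independent_processes P Y Z \<longleftrightarrow>
     prob_space.indep_set P (process_algebra P Y) (process_algebra P Z)"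

section \<open>The driving noises\<close>

definition brownian_motion ::
  "'w measure \<Rightarrow> (real \<Rightarrow> 'w measure) \<Rightarrow> (real \<Rightarrow> 'w \<Rightarrow> real) \<Rightarrow> bool" where
  "brownian_motion P F W \<longleftrightarrow>
     adapted F W \<and>
     (AE \<omega> in P. W 0 \<omega> = 0) \<and>
     (AE \<omega> in P. continuous_on {0..} (\<lambda>t. W t \<omega>)) \<and>
     indep_increments_wrt P F W \<and>
     (\<forall>s t. 0 \<le> s \<and> s < t \<longrightarrow>
        distributed P lborel (\<lambda>\<omega>. W t \<omega> - W s \<omega>) (normal_density 0 (sqrt (t - s))))"

text \<open>
  A Levy measure on \<open>(0,\<infinity>)\<close> of finite variation type, as a Borel measure on the real line that
  gives no mass to the complement of \<open>(0,\<infinity>)\<close>.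
\<close>

definition positive_levy_measure :: "real measure \<Rightarrow> bool" where
  "positive_levy_measure \<nu> \<longleftrightarrow>
     sets \<nu> = sets borel \<and> emeasure \<nu> {..0} = 0 \<and>
     (\<integral>\<^sup>+\<xi>\<in>{0<..}. ennreal (min \<xi> 1) \<partial>\<nu>) < \<infinity>"

text \<open>
  The last clause says that there is neither drift nor Gaussian part and that all jumps are
  positive. The right-hand side never vanishes, so the clause also forces the exponential on the
  left to be integrable (a Bochner integral of a non-integrable function is 0).
\<close>

definition pure_jump_levy_process ::
  "'w measure \<Rightarrow> (real \<Rightarrow> 'w measure) \<Rightarrow> real measure \<Rightarrow> (real \<Rightarrow> 'w \<Rightarrow> real) \<Rightarrow> bool" where
  "pure_jump_levy_process P F \<nu> J \<longleftrightarrow>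
     adapted F J \<and>
     (AE \<omega> in P. J 0 \<omega> = 0) \<and>
     (AE \<omega> in P. cadlag (\<lambda>t. J t \<omega>)) \<and>
     indep_increments_wrt P F J \<and>
     (\<forall>s t. 0 \<le> s \<and> s < t \<longrightarrow>
        distr P borel (\<lambda>\<omega>. J t \<omega> - J s \<omega>) = distr P borel (J (t - s))) \<and>
     (\<forall>t\<ge>0. \<forall>u::complex. Re u \<le> 0 \<longrightarrow>
        (\<integral>\<omega>. exp (u * of_real (J t \<omega>)) \<partial>P) =
          exp (of_real t * set_lebesgue_integral \<nu> {0<..} (\<lambda>\<xi>. exp (u * of_real \<xi>) - 1)))"

section \<open>The Ito integral\<close>

text \<open>
  The data \<open>n, \<tau>, \<xi>\<close> represent the simple process
  \<open>\<Sum>i<n. \<xi> i * 1_{(\<tau> i, \<tau> (i + 1)]}\<close>.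
\<close>

definition simple_process ::
  "'w measure \<Rightarrow> (real \<Rightarrow> 'w measure) \<Rightarrow> nat \<Rightarrow> (nat \<Rightarrow> real) \<Rightarrow> (nat \<Rightarrow> 'w \<Rightarrow> real) \<Rightarrow> bool" where
  "simple_process P F n \<tau> \<xi> \<longleftrightarrow>
     0 \<le> \<tau> 0 \<and> (\<forall>i<n. \<tau> i < \<tau> (Suc i)) \<and>
     (\<forall>i<n. \<xi> i \<in> borel_measurable (F (\<tau> i)) \<and> (\<exists>C. \<forall>\<omega>\<in>space P. \<bar>\<xi> i \<omega>\<bar> \<le> C))"

definition simple_value ::
  "nat \<Rightarrow> (nat \<Rightarrow> real) \<Rightarrow> (nat \<Rightarrow> 'w \<Rightarrow> real) \<Rightarrow> real \<Rightarrow> 'w \<Rightarrow> real" where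
  "simple_value n \<tau> \<xi> s \<omega> = (\<Sum>i<n. \<xi> i \<omega> * indicator {\<tau> i<..\<tau> (Suc i)} s)"

definition simple_integral ::
  "(real \<Rightarrow> 'w \<Rightarrow> real) \<Rightarrow> nat \<Rightarrow> (nat \<Rightarrow> real) \<Rightarrow> (nat \<Rightarrow> 'w \<Rightarrow> real) \<Rightarrow> real \<Rightarrow> 'w \<Rightarrow> real" where
  "simple_integral W n \<tau> \<xi> t \<omega> =
     (\<Sum>i<n. \<xi> i \<omega> * (W (min (\<tau> (Suc i)) t) \<omega> - W (min (\<tau> i) t) \<omega>))"

text \<open>
  Convergence to 0 in probability. The measurable covers \<open>A k\<close> make this convergence in outer
  probability, so that suprema over uncountable time sets need no separate measurability argument.
\<close>

definition tends_to_0_in_prob :: "'w measure \<Rightarrow> (nat \<Rightarrow> 'w \<Rightarrow> ennreal) \<Rightarrow> bool" where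
  "tends_to_0_in_prob P Y \<longleftrightarrow>
     (\<forall>\<epsilon>>0. \<exists>A. (\<forall>k. A k \<in> sets P \<and> {\<omega>\<in>space P. \<epsilon> < Y k \<omega>} \<subseteq> A k) \<and>
        (\<lambda>k. measure P (A k)) \<longlonglongrightarrow> 0)"

text \<open>
  \<open>I t = \<integral>\<^bsub>0\<^esub>\<^bsup>t\<^esup> H dW\<close> for progressively measurable \<open>H\<close> with locally square-integrable paths: the
  continuous limit, uniformly on compact time intervals in probability, of the integrals of simple
  processes that approximate \<open>H\<close> in \<open>L\<^sup>2([0,T])\<close> in probability for all \<open>T\<close>. It is determined up to
  indistinguishability.
\<close>

definition has_ito_integral ::
  "'w measure \<Rightarrow> (real \<Rightarrow> 'w measure) \<Rightarrow> (real \<Rightarrow> 'w \<Rightarrow> real) \<Rightarrow>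
   (real \<Rightarrow> 'w \<Rightarrow> real) \<Rightarrow> (real \<Rightarrow> 'w \<Rightarrow> real) \<Rightarrow> bool" where
  "has_ito_integral P F W H I \<longleftrightarrow>
     progressively_measurable F H \<and>
     (AE \<omega> in P. \<forall>T\<ge>0. (\<integral>\<^sup>+s\<in>{0..T}. ennreal ((H s \<omega>)\<^sup>2) \<partial>lborel) < \<infinity>) \<and>
     (\<forall>t\<ge>0. I t \<in> borel_measurable P) \<and>
     (AE \<omega> in P. continuous_on {0..} (\<lambda>t. I t \<omega>)) \<and>
     (\<exists>n \<tau> \<xi>.
        (\<forall>k. simple_process P F (n k) (\<tau> k) (\<xi> k)) \<and>
        (\<forall>T\<ge>0. tends_to_0_in_prob P
           (\<lambda>k \<omega>. \<integral>\<^sup>+s\<in>{0..T}. ennreal ((simple_value (n k) (\<tau> k) (\<xi> k) s \<omega> - H s \<omega>)\<^sup>2) \<partial>lborel)) \<and>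
        (\<forall>T\<ge>0. tends_to_0_in_prob P
           (\<lambda>k \<omega>. SUP t\<in>{0..T}. ennreal \<bar>simple_integral W (n k) (\<tau> k) (\<xi> k) t \<omega> - I t \<omega>\<bar>)))"

section \<open>The JCIR process\<close>

text \<open>
  \<open>X\<close> is a solution, with values in \<open>[0,\<infinity>)\<close>, of
  \<open>dX = a (\<theta> - X) dt + \<sigma> sqrt X dW + dJ\<close>, \<open>X 0 = x\<close>, for the given noises \<open>W\<close> and \<open>J\<close>.
  The integrand \<open>H\<close> is \<open>sqrt X\<close> up to indistinguishability: paths of \<open>X\<close> are cadlag only almost
  surely, so \<open>sqrt X\<close> itself may fail to be progressively measurable on a null set of outcomes.
\<close>

definition jcir_process ::
  "'w measure \<Rightarrow> (real \<Rightarrow> 'w measure) \<Rightarrow> (real \<Rightarrow> 'w \<Rightarrow> real) \<Rightarrow> (real \<Rightarrow> 'w \<Rightarrow> real) \<Rightarrow>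
   real \<Rightarrow> real \<Rightarrow> real \<Rightarrow> real \<Rightarrow> (real \<Rightarrow> 'w \<Rightarrow> real) \<Rightarrow> bool" where
  "jcir_process P F W J a \<theta> \<sigma> x X \<longleftrightarrow>
     adapted F X \<and>
     (AE \<omega> in P. cadlag (\<lambda>t. X t \<omega>)) \<and>
     (AE \<omega> in P. \<forall>t\<ge>0. 0 \<le> X t \<omega>) \<and>
     (AE \<omega> in P. X 0 \<omega> = x) \<and>
     (AE \<omega> in P. \<forall>t\<ge>0. set_integrable lborel {0..t} (\<lambda>s. a * (\<theta> - X s \<omega>))) \<and>
     (\<exists>H I. (AE \<omega> in P. \<forall>s\<ge>0. H s \<omega> = sqrt (X s \<omega>)) \<and>
        has_ito_integral P F W H I \<and>
        (AE \<omega> in P. \<forall>t\<ge>0.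
           X t \<omega> = x + (LBINT s:{0..t}. a * (\<theta> - X s \<omega>)) + \<sigma> * I t \<omega> + J t \<omega>))"

text \<open>
  \<open>X x\<close> is the process started from \<open>x\<close>. Integrability is explicit because a Bochner integral of a
  non-integrable function is 0.
\<close>

definition forster_lyapunov ::
  "'w measure \<Rightarrow> (real \<Rightarrow> real \<Rightarrow> 'w \<Rightarrow> real) \<Rightarrow> real \<Rightarrow> (real \<Rightarrow> real) \<Rightarrow> bool" where
  "forster_lyapunov P X a V \<longleftrightarrow>
     (\<exists>M>0. \<forall>t>0. \<forall>x\<ge>0.
        integrable P (\<lambda>\<omega>. V (X x t \<omega>)) \<and>
        (\<integral>\<omega>. V (X x t \<omega>) \<partial>P) \<le> exp (- a * t) * V x + M)"

end

theory Submission
  imports Defs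
begin

text \<open>
  Why the mean of the JCIR process decays at rate \<open>a\<close>: in the equation the drift pulls the mean
  \<open>f t = E[X t]\<close> back at rate \<open>a\<close>, the constant part \<open>a \<theta>\<close> of the drift and the jumps push it up
  at the finite rate \<open>c = a \<theta> + \<integral> \<xi> \<nu>(d\<xi>)\<close>, and the stochastic integral \<open>I\<close> should not contribute. So \<open>f\<close>
  satisfies \<open>f t + a \<integral>\<^bsub>s\<^esub>\<^bsup>t\<^esup> f dr \<le> f s + c (t - s)\<close>, and a Gronwall argument gives
  \<open>f t \<le> exp (- a t) x + c / a\<close>.

  The difficulty is that \<open>I\<close> is a priori only a local martingale and that nothing is known about the
  moments of \<open>X\<close>. Instead of localizing with stopping times, the proof uses exponentials. For simple
  integrands \<open>h\<close> the variable \<open>exp (l (I t - I s) - l\<^sup>2 / 2 \<integral>\<^bsub>s\<^esub>\<^bsup>t\<^esup> h\<^sup>2 dr)\<close> has mean exactly 1, by independence and a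
  Gaussian computation (\<open>nn_integral_exp_simple_integral\<close>). Being positive, it passes to the limit
  by Fatou's lemma: \<open>E[exp (l (I t - I s) - l\<^sup>2 \<integral>\<^bsub>s\<^esub>\<^bsup>t\<^esup> X dr)] \<le> 1\<close> (\<open>nn_integral_exp_ito_integral_le\<close>). Linearizing with
  \<open>1 + z \<le> exp z\<close> shows that the mean of \<open>I t - I s\<close> is at most \<open>l E[\<integral>\<^bsub>s\<^esub>\<^bsup>t\<^esup> X dr]\<close>. The very same integral occurs
  with the factor \<open>a\<close> in the drift and, for small \<open>l\<close>, absorbs this error; the inequality for \<open>f\<close>
  results with any rate \<open>b < a\<close> (\<open>jcir_mean_step\<close>), and \<open>b\<close> tends to \<open>a\<close> only at the end.

  The jump part enters through \<open>J t - J s \<ge> 0\<close> and \<open>E[J t - J s] \<le> (t - s) \<integral> \<xi> \<nu>(d\<xi>)\<close>, both consequences of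
  the Laplace transform of the increments (\<open>levy_increment_nonneg_mean\<close>).
\<close>

section \<open>Exponentials of sums of Gaussian increments\<close>

text \<open>
  Completing the square: tilting a centred Gaussian by \<open>exp (b w - b\<^sup>2 v / 2)\<close> only moves its mean
  to \<open>b v\<close>.
\<close>

lemma nn_integral_exp_normal_density:
  fixes b v :: real
  assumes "0 < v"
  shows "(\<integral>\<^sup>+ w. ennreal (exp (b * w - b\<^sup>2 * v / 2)) \<partial>density lborel (normal_density 0 (sqrt v))) = 1"
proof -
  have *: "normal_density 0 (sqrt v) w * exp (b * w - b\<^sup>2 * v / 2) = normal_density (b * v) (sqrt v) w" for w
  proof -
    have "- (w\<^sup>2) / (2 * v) + (b * w - b\<^sup>2 * v / 2) = - ((w - b * v)\<^sup>2) / (2 * v)"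
      using assms by (simp add: field_simps power2_eq_square)
    then show ?thesis
      using assms unfolding normal_density_def
      by (simp add: exp_add[symmetric])
  qed
  have "(\<integral>\<^sup>+ w. ennreal (exp (b * w - b\<^sup>2 * v / 2)) \<partial>density lborel (normal_density 0 (sqrt v)))
    = (\<integral>\<^sup>+ w. ennreal (normal_density (b * v) (sqrt v) w) \<partial>lborel)"
    using assms by (subst nn_integral_density) (auto simp: *[symmetric] ennreal_mult intro!: nn_integral_cong)
  also have "\<dots> = emeasure (density lborel (normal_density (b * v) (sqrt v))) UNIV"
    by (subst emeasure_density) auto
  also have "\<dots> = 1"
    using prob_space.emeasure_space_1[OF prob_space_normal_density[of "sqrt v" "b * v"]] assms by simp
  finally show ?thesis .
qed

text \<open>
  One step of the exponential martingale. The coefficient \<open>y\<close> and the past \<open>D\<close> are known at the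
  start of the increment \<open>Z\<close>, so by independence they may be frozen while the Gaussian integral over
  \<open>Z\<close> is evaluated.
\<close>

lemma nn_integral_exp_independent_normal:
  fixes D :: "'w \<Rightarrow> ennreal" and y Z :: "'w \<Rightarrow> real" and G P :: "'w measure"
  assumes P: "prob_space P" and space: "space G = space P"
    and indep: "prob_space.indep_set P (sets G) (sets (vimage_algebra (space P) Z borel))"
    and Z: "distributed P lborel Z (normal_density 0 (sqrt v))" and "0 < v"
    and D: "D \<in> borel_measurable G" and y: "y \<in> borel_measurable G"
  shows "(\<integral>\<^sup>+ \<omega>. D \<omega> * ennreal (exp (y \<omega> * Z \<omega> - (y \<omega>)\<^sup>2 * v / 2)) \<partial>P) = (\<integral>\<^sup>+ \<omega>. D \<omega> \<partial>P)"
proof -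
  interpret P: prob_space P by fact
  have sub: "sets G \<subseteq> sets P" using P.indep_setD_ev1[OF indep] .
  let ?T = "borel \<Otimes>\<^sub>M borel :: (ennreal \<times> real) measure"
  let ?U = "\<lambda>\<omega>. (D \<omega>, y \<omega>)"
  have UG: "?U \<in> measurable G ?T" using D y by measurable
  have id: "(\<lambda>x. x) \<in> measurable P G"
    using sub space by (intro measurableI) (auto dest: sets.sets_into_space)
  have U[measurable]: "?U \<in> measurable P ?T"
    using measurable_compose[OF id UG] .
  have Zm[measurable]: "Z \<in> borel_measurable P" using Z by (simp add: distributed_def)
  have dZ: "distr P borel Z = density lborel (normal_density 0 (sqrt v))"
    using Z unfolding distributed_def by (metis distr_cong sets_lborel)
  \<comment> \<open>\<open>indep_var\<close> speaks about two variables of the same type, so \<open>Z\<close> is padded with a dummy coordinate.\<close>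
  let ?V = "\<lambda>\<omega>. (0 :: ennreal, Z \<omega>)"
  have VG: "?V \<in> measurable (vimage_algebra (space P) Z borel) ?T"
    using measurable_vimage_algebra1[of Z "space P" borel] by measurable
  have V[measurable]: "?V \<in> measurable P ?T" by measurable
  have "P.indep_var ?T ?U ?T ?V"
    unfolding P.indep_var_eq
  proof (intro conjI U V)
    show "P.indep_set (sigma_sets (space P) {?U -` A \<inter> space P |A. A \<in> sets ?T})
     (sigma_sets (space P) {?V -` A \<inter> space P |A. A \<in> sets ?T})"
      using indep unfolding P.indep_set_def
    proof (rule P.indep_sets_mono_sets)
      fix i :: bool
      have 1: "sigma_sets (space P) {?U -` A \<inter> space P |A. A \<in> sets ?T} \<subseteq> sets G"
        unfolding space[symmetric] by (intro sets.sigma_sets_subset) (auto intro!: measurable_sets[OF UG])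
      have "?V -` A \<inter> space P \<in> sets (vimage_algebra (space P) Z borel)" if "A \<in> sets ?T" for A
        using measurable_sets[OF VG that] by (simp only: space_vimage_algebra)
      then have "{?V -` A \<inter> space P |A. A \<in> sets ?T} \<subseteq> sets (vimage_algebra (space P) Z borel)"
        by blast
      from sets.sigma_sets_subset[OF this]
      have 2: "sigma_sets (space P) {?V -` A \<inter> space P |A. A \<in> sets ?T}
          \<subseteq> sets (vimage_algebra (space P) Z borel)"
        by (simp only: space_vimage_algebra)
      show "(case i of True \<Rightarrow> sigma_sets (space P) {?U -` A \<inter> space P |A. A \<in> sets ?T}
             | False \<Rightarrow> sigma_sets (space P) {?V -` A \<inter> space P |A. A \<in> sets ?T})
         \<subseteq> (case i of True \<Rightarrow> sets G | False \<Rightarrow> sets (vimage_algebra (space P) Z borel))"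
        by (cases i) (simp_all only: bool.case 1 2)
    qed
  qed
  then have joint: "distr P (?T \<Otimes>\<^sub>M ?T) (\<lambda>\<omega>. (?U \<omega>, ?V \<omega>)) = distr P ?T ?U \<Otimes>\<^sub>M distr P ?T ?V"
    unfolding P.indep_var_distribution_eq by (elim conjE) (rule sym)
  interpret V: prob_space "distr P ?T ?V" by (rule P.prob_space_distr) simp
  let ?f = "\<lambda>(u :: ennreal \<times> real, z :: ennreal \<times> real).
    fst u * ennreal (exp (snd u * snd z - (snd u)\<^sup>2 * v / 2))"
  have f: "?f \<in> borel_measurable (?T \<Otimes>\<^sub>M ?T)" by measurable
  have inner: "(\<integral>\<^sup>+ z. ?f (u, z) \<partial>distr P ?T ?V) = fst u" for u
  proof -
    have "(\<integral>\<^sup>+ z. ?f (u, z) \<partial>distr P ?T ?V)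
        = fst u * (\<integral>\<^sup>+ z. ennreal (exp (snd u * snd z - (snd u)\<^sup>2 * v / 2)) \<partial>distr P ?T ?V)"
      by (simp add: nn_integral_cmult)
    also have "(\<integral>\<^sup>+ z. ennreal (exp (snd u * snd z - (snd u)\<^sup>2 * v / 2)) \<partial>distr P ?T ?V)
        = (\<integral>\<^sup>+ z. ennreal (exp (snd u * z - (snd u)\<^sup>2 * v / 2)) \<partial>distr P borel Z)"
      by (simp add: nn_integral_distr)
    also have "\<dots> = 1"
      unfolding dZ by (rule nn_integral_exp_normal_density[OF \<open>0 < v\<close>])
    finally show ?thesis by simp
  qed
  have "(\<integral>\<^sup>+ \<omega>. D \<omega> * ennreal (exp (y \<omega> * Z \<omega> - (y \<omega>)\<^sup>2 * v / 2)) \<partial>P)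
     = (\<integral>\<^sup>+ p. ?f p \<partial>distr P (?T \<Otimes>\<^sub>M ?T) (\<lambda>\<omega>. (?U \<omega>, ?V \<omega>)))"
    by (subst nn_integral_distr) (use f in auto)
  also have "\<dots> = (\<integral>\<^sup>+ u. \<integral>\<^sup>+ z. ?f (u, z) \<partial>distr P ?T ?V \<partial>distr P ?T ?U)"
    unfolding joint by (rule V.nn_integral_fst[symmetric]) (use f in simp)
  also have "\<dots> = (\<integral>\<^sup>+ u. fst u \<partial>distr P ?T ?U)"
    using inner by (intro nn_integral_cong) auto
  also have "\<dots> = (\<integral>\<^sup>+ \<omega>. D \<omega> \<partial>P)"
    by (subst nn_integral_distr) auto
  finally show ?thesis .
qed

text \<open>
  The discrete stochastic exponential has mean 1. Coefficients need to be measurable only where the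
  partition \<open>c\<close> really moves: this lets a partition be clamped to a subinterval, which collapses some
  of its intervals to points.
\<close>

lemma nn_integral_exp_gaussian_sum:
  assumes P: "filtered_prob_space P F" and W: "brownian_motion P F W"
    and "0 \<le> c 0" and mono: "\<And>i. i < n \<Longrightarrow> c i \<le> c (Suc i)"
    and \<xi>: "\<And>i. i < n \<Longrightarrow> c i < c (Suc i) \<Longrightarrow> \<xi> i \<in> borel_measurable (F (c i))"
  defines "E \<equiv> \<lambda>n \<omega>. ennreal (exp (\<Sum>i<n. \<xi> i \<omega> * (W (c (Suc i)) \<omega> - W (c i) \<omega>)
                               - (\<xi> i \<omega>)\<^sup>2 * (c (Suc i) - c i) / 2))"
  shows "E n \<in> borel_measurable (F (c n)) \<and> (\<integral>\<^sup>+ \<omega>. E n \<omega> \<partial>P) = 1 \<and> 0 \<le> c n"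
  using mono \<xi>
proof (induction n)
  case 0
  interpret prob_space P using P by (simp add: filtered_prob_space_def)
  show ?case using \<open>0 \<le> c 0\<close> emeasure_space_1 by (simp add: E_def)
next
  case (Suc n)
  interpret prob_space P using P by (simp add: filtered_prob_space_def)
  interpret filtration "space P" F using P by (simp add: filtered_prob_space_def)
  have IH: "E n \<in> borel_measurable (F (c n))" "(\<integral>\<^sup>+ \<omega>. E n \<omega> \<partial>P) = 1" "0 \<le> c n"
    using Suc by auto
  show ?case
  proof (cases "c n = c (Suc n)")
    case True
    then have "E (Suc n) = E n" by (simp add: E_def)
    then show ?thesis using IH True by simp
  next
    case False
    then have lt: "c n < c (Suc n)" using Suc.prems(1)[of n] by simp
    define Z where "Z = (\<lambda>\<omega>. W (c (Suc n)) \<omega> - W (c n) \<omega>)"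
    have y: "\<xi> n \<in> borel_measurable (F (c n))" using Suc.prems(2) lt by simp
    have up: "g \<in> borel_measurable (F (c (Suc n)))" if "g \<in> borel_measurable (F (c n))"
      for g :: "'a \<Rightarrow> 'b::topological_space"
      using measurable_mono[of borel borel "F (c n)" "F (c (Suc n))"] that sets_F_mono[of "c n" "c (Suc n)"] lt
      by (auto simp: space_F)
    have W': "W t \<in> borel_measurable (F t)" if "0 \<le> t" for t
      using W that by (auto simp: brownian_motion_def adapted_def)
    have E: "E (Suc n) = (\<lambda>\<omega>. E n \<omega> * ennreal (exp (\<xi> n \<omega> * Z \<omega> - (\<xi> n \<omega>)\<^sup>2 * (c (Suc n) - c n) / 2)))"
      by (auto simp: E_def Z_def ennreal_mult'[symmetric] exp_add[symmetric])
    have [measurable]: "E n \<in> borel_measurable (F (c (Suc n)))" "\<xi> n \<in> borel_measurable (F (c (Suc n)))"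
      "Z \<in> borel_measurable (F (c (Suc n)))"
      unfolding Z_def using up[OF IH(1)] up[OF y] up[OF W'[OF IH(3)]] W'[of "c (Suc n)"] IH(3) lt by auto
    have "(\<integral>\<^sup>+ \<omega>. E (Suc n) \<omega> \<partial>P) = (\<integral>\<^sup>+ \<omega>. E n \<omega> \<partial>P)"
      unfolding E
    proof (rule nn_integral_exp_independent_normal[of P "F (c n)"])
      show "indep_set (sets (F (c n))) (sets (vimage_algebra (space P) Z borel))"
        using W lt IH(3) unfolding brownian_motion_def indep_increments_wrt_def Z_def by auto
      show "distributed P lborel Z (normal_density 0 (sqrt (c (Suc n) - c n)))"
        using W lt IH(3) unfolding brownian_motion_def Z_def by auto
    qed (use IH y lt in \<open>auto simp: space_F prob_space_axioms\<close>)
    then show ?thesis using IH lt unfolding E by auto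
  qed
qed

section \<open>Exponential bounds for the Ito integral\<close>

text \<open>
  Clamping the partition points to \<open>[s, t]\<close> turns an increment of a simple integral into a full sum
  of the kind treated above.
\<close>

lemma clamped_simple_integral_diff:
  fixes s t :: real
  assumes "s \<le> t"
  defines "c \<equiv> \<lambda>r. max s (min t r)"
  shows "simple_integral W n \<tau> \<xi> t \<omega> - simple_integral W n \<tau> \<xi> s \<omega>
       = (\<Sum>i<n. \<xi> i \<omega> * (W (c (\<tau> (Suc i))) \<omega> - W (c (\<tau> i)) \<omega>))"
proof -
  have *: "W (min r t) \<omega> - W (min r s) \<omega> = W (c r) \<omega> - W s \<omega>" for r
    using assms by (auto simp: c_def min_def max_def)
  have "\<xi> i \<omega> * (W (min (\<tau> (Suc i)) t) \<omega> - W (min (\<tau> i) t) \<omega>)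
      - \<xi> i \<omega> * (W (min (\<tau> (Suc i)) s) \<omega> - W (min (\<tau> i) s) \<omega>)
      = \<xi> i \<omega> * (W (c (\<tau> (Suc i))) \<omega> - W (c (\<tau> i)) \<omega>)" for i
    using *[of "\<tau> (Suc i)"] *[of "\<tau> i"] unfolding right_diff_distrib[symmetric]
    by (intro arg_cong[where f = "\<lambda>x. \<xi> i \<omega> * x"]) linarith
  then show ?thesis
    unfolding simple_integral_def by (simp add: sum_subtractf[symmetric])
qed

lemma simple_value_sq:
  assumes "\<And>i. i < n \<Longrightarrow> \<tau> i < \<tau> (Suc i)"
  shows "(simple_value n \<tau> \<xi> r \<omega>)\<^sup>2 = (\<Sum>i<n. (\<xi> i \<omega>)\<^sup>2 * indicator {\<tau> i<..\<tau> (Suc i)} r)"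
  using assms
proof (induction n)
  case 0
  then show ?case by (simp add: simple_value_def)
next
  case (Suc n)
  have IH: "(simple_value n \<tau> \<xi> r \<omega>)\<^sup>2 = (\<Sum>i<n. (\<xi> i \<omega>)\<^sup>2 * indicator {\<tau> i<..\<tau> (Suc i)} r)"
    using Suc by simp
  have S: "simple_value (Suc n) \<tau> \<xi> r \<omega> = simple_value n \<tau> \<xi> r \<omega> + \<xi> n \<omega> * indicator {\<tau> n<..\<tau> (Suc n)} r"
    by (simp add: simple_value_def)
  show ?case
  proof (cases "\<tau> n < r \<and> r \<le> \<tau> (Suc n)")
    case True
    have le: "\<tau> (Suc i) \<le> \<tau> n" if "i < n" for i
    proof -
      have "Suc i \<le> n" using that by simp
      then show ?thesis
      proof (induction rule: inc_induct)
        case (step m)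
        then show ?case using Suc.prems[of m] by simp
      qed simp
    qed
    have "simple_value n \<tau> \<xi> r \<omega> = 0"
      unfolding simple_value_def
    proof (intro sum.neutral ballI)
      fix i assume "i \<in> {..<n}"
      with le[of i] True show "\<xi> i \<omega> * indicator {\<tau> i<..\<tau> (Suc i)} r = 0" by simp
    qed
    then show ?thesis using IH True unfolding S by simp
  next
    case False
    then show ?thesis using IH unfolding S by simp
  qed
qed

text \<open>
  The witness \<open>Q\<close> is \<open>\<integral>\<^bsub>s\<^esub>\<^bsup>t\<^esup> h\<^sup>2 dr\<close> for the simple process \<open>h\<close>, written as a finite sum. Only the upper
  bound by the integral matters, because a smaller \<open>Q\<close> makes the exponential larger.
\<close>

lemma nn_integral_exp_simple_integral:
  assumes P: "filtered_prob_space P F" and W: "brownian_motion P F W"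
    and simple: "simple_process P F n \<tau> \<xi>" and st: "0 \<le> s" "s < t"
  shows "\<exists>Q. (\<forall>\<omega>. ennreal (Q \<omega>) \<le> (\<integral>\<^sup>+r\<in>{s..t}. ennreal ((simple_value n \<tau> \<xi> r \<omega>)\<^sup>2) \<partial>lborel))
    \<and> (\<lambda>\<omega>. ennreal (exp (l * (simple_integral W n \<tau> \<xi> t \<omega> - simple_integral W n \<tau> \<xi> s \<omega>)
              - l\<^sup>2 * Q \<omega> / 2))) \<in> borel_measurable P
    \<and> (\<integral>\<^sup>+\<omega>. ennreal (exp (l * (simple_integral W n \<tau> \<xi> t \<omega> - simple_integral W n \<tau> \<xi> s \<omega>)
              - l\<^sup>2 * Q \<omega> / 2)) \<partial>P) = 1"
proof -
  let ?E = "\<lambda>Q \<omega>. ennreal (exp (l * (simple_integral W n \<tau> \<xi> t \<omega> - simple_integral W n \<tau> \<xi> s \<omega>)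
              - l\<^sup>2 * Q \<omega> / 2))"
  define c where "c i = max s (min t (\<tau> i))" for i
  define Q where "Q \<omega> = (\<Sum>i<n. (\<xi> i \<omega>)\<^sup>2 * (c (Suc i) - c i))" for \<omega>
  have \<tau>: "\<tau> i < \<tau> (Suc i)" if "i < n" for i using simple that by (auto simp: simple_process_def)
  have mono: "c i \<le> c (Suc i)" if "i < n" for i
    using \<tau>[OF that] by (auto simp: c_def)
  interpret filtration "space P" F using P by (simp add: filtered_prob_space_def)
  have \<xi>: "(\<lambda>\<omega>. l * \<xi> i \<omega>) \<in> borel_measurable (F (c i))" if "i < n" "c i < c (Suc i)" for i
  proof -
    \<comment> \<open>An interval that survives the clamping starts no earlier than before, when \<open>\<xi> i\<close> is known.\<close>
    have "\<tau> i \<le> c i" using that by (auto simp: c_def min_def max_def split: if_splits)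
    moreover have "\<xi> i \<in> borel_measurable (F (\<tau> i))"
      using simple that by (auto simp: simple_process_def)
    ultimately have "\<xi> i \<in> borel_measurable (F (c i))"
      using measurable_mono[of borel borel "F (\<tau> i)" "F (c i)"] sets_F_mono[of "\<tau> i" "c i"]
      by (auto simp: space_F)
    then show ?thesis by simp
  qed
  have eq: "?E Q = (\<lambda>\<omega>. ennreal (exp (\<Sum>i<n. l * \<xi> i \<omega> * (W (c (Suc i)) \<omega> - W (c i) \<omega>)
                               - (l * \<xi> i \<omega>)\<^sup>2 * (c (Suc i) - c i) / 2)))"
  proof
    fix \<omega>
    have "simple_integral W n \<tau> \<xi> t \<omega> - simple_integral W n \<tau> \<xi> s \<omega>
        = (\<Sum>i<n. \<xi> i \<omega> * (W (c (Suc i)) \<omega> - W (c i) \<omega>))"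
      unfolding c_def using st by (intro clamped_simple_integral_diff) simp
    moreover have "l * (\<Sum>i<n. \<xi> i \<omega> * (W (c (Suc i)) \<omega> - W (c i) \<omega>)) - l\<^sup>2 * Q \<omega> / 2
        = (\<Sum>i<n. l * \<xi> i \<omega> * (W (c (Suc i)) \<omega> - W (c i) \<omega>) - (l * \<xi> i \<omega>)\<^sup>2 * (c (Suc i) - c i) / 2)"
      unfolding Q_def sum_distrib_left sum_divide_distrib sum_subtractf[symmetric]
      by (intro sum.cong refl) (simp add: power_mult_distrib mult.assoc)
    ultimately show "?E Q \<omega> = ennreal (exp (\<Sum>i<n. l * \<xi> i \<omega> * (W (c (Suc i)) \<omega> - W (c i) \<omega>)
                               - (l * \<xi> i \<omega>)\<^sup>2 * (c (Suc i) - c i) / 2))"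
      by simp
  qed
  have "c 0 \<ge> 0" using st by (simp add: c_def)
  from nn_integral_exp_gaussian_sum[where n = n and c = c and \<xi> = "\<lambda>i \<omega>. l * \<xi> i \<omega>", OF P W this mono \<xi>]
  have E: "?E Q \<in> borel_measurable (F (c n))" "(\<integral>\<^sup>+\<omega>. ?E Q \<omega> \<partial>P) = 1"
    unfolding eq by auto
  have "sets (F (c n)) \<subseteq> sets P" using P by (simp add: filtered_prob_space_def)
  then have E': "?E Q \<in> borel_measurable P"
    using E(1) measurable_mono[of borel borel "F (c n)" P] by (auto simp: space_F)
  have le: "ennreal (Q \<omega>) \<le> (\<integral>\<^sup>+r\<in>{s..t}. ennreal ((simple_value n \<tau> \<xi> r \<omega>)\<^sup>2) \<partial>lborel)" for \<omega>
  proof -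
    have "ennreal (Q \<omega>) = (\<Sum>i<n. ennreal ((\<xi> i \<omega>)\<^sup>2) * emeasure lborel {c i<..c (Suc i)})"
      unfolding Q_def using mono
      by (subst sum_ennreal[symmetric]) (auto intro!: sum.cong simp: ennreal_mult)
    also have "\<dots> = (\<integral>\<^sup>+r. (\<Sum>i<n. ennreal ((\<xi> i \<omega>)\<^sup>2) * indicator {c i<..c (Suc i)} r) \<partial>lborel)"
      by (subst nn_integral_sum) (auto simp: nn_integral_cmult_indicator)
    also have "\<dots> \<le> (\<integral>\<^sup>+r\<in>{s..t}. ennreal ((simple_value n \<tau> \<xi> r \<omega>)\<^sup>2) \<partial>lborel)"
    proof (rule nn_integral_mono)
      fix r
      have ind: "indicator {c i<..c (Suc i)} r \<le> (indicator {\<tau> i<..\<tau> (Suc i)} r * indicator {s..t} r :: ennreal)" for i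
        using st by (auto simp: c_def min_def max_def indicator_def split: if_splits)
      have "(\<Sum>i<n. ennreal ((\<xi> i \<omega>)\<^sup>2) * indicator {c i<..c (Suc i)} r)
          \<le> (\<Sum>i<n. ennreal ((\<xi> i \<omega>)\<^sup>2) * (indicator {\<tau> i<..\<tau> (Suc i)} r * indicator {s..t} r))"
        by (intro sum_mono mult_left_mono ind) auto
      also have "\<dots> = (\<Sum>i<n. ennreal ((\<xi> i \<omega>)\<^sup>2 * indicator {\<tau> i<..\<tau> (Suc i)} r)) * indicator {s..t} r"
        by (simp add: sum_distrib_right ennreal_mult ennreal_indicator mult.assoc del: sum_mult_indicator)
      also have "\<dots> = ennreal ((simple_value n \<tau> \<xi> r \<omega>)\<^sup>2) * indicator {s..t} r"
        using simple_value_sq[of n \<tau> \<xi> r \<omega>] \<tau> by (simp add: sum_ennreal)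
      finally show "(\<Sum>i<n. ennreal ((\<xi> i \<omega>)\<^sup>2) * indicator {c i<..c (Suc i)} r)
          \<le> ennreal ((simple_value n \<tau> \<xi> r \<omega>)\<^sup>2) * indicator {s..t} r" .
    qed
    finally show ?thesis .
  qed
  show ?thesis
    using le E' E(2) by blast
qed

text \<open>
  The usual Borel--Cantelli argument, run on the measurable covers.
\<close>

lemma tends_to_0_in_prob_subseq:
  assumes "prob_space P" "tends_to_0_in_prob P Y"
  obtains r :: "nat \<Rightarrow> nat" where "strict_mono r" "AE \<omega> in P. (\<lambda>k. Y (r k) \<omega>) \<longlonglongrightarrow> 0"
proof -
  interpret prob_space P by fact
  have "\<forall>m. \<exists>A. (\<forall>k. A k \<in> sets P \<and> {\<omega>\<in>space P. ennreal ((1/2)^m) < Y k \<omega>} \<subseteq> A k) \<and>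
        (\<lambda>k. measure P (A k)) \<longlonglongrightarrow> 0"
    using assms(2) unfolding tends_to_0_in_prob_def by auto
  then obtain A where A: "\<And>m k. A m k \<in> sets P"
      "\<And>m k. {\<omega>\<in>space P. ennreal ((1/2)^m) < Y k \<omega>} \<subseteq> A m k"
      "\<And>m. (\<lambda>k. measure P (A m k)) \<longlonglongrightarrow> 0"
    by metis
  have ex: "\<exists>k>j. measure P (A m k) < (1/2)^m" for m j
  proof -
    have "\<forall>\<^sub>F k in sequentially. measure P (A m k) < (1/2)^m"
      using A(3)[of m] by (rule order_tendstoD) simp
    then have "\<forall>\<^sub>F k in sequentially. measure P (A m k) < (1/2)^m \<and> k > j"
      using eventually_gt_at_top[of j] by (rule eventually_conj)
    then show ?thesis unfolding eventually_sequentially by blast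
  qed
  have "\<exists>r. \<forall>m. measure P (A m (r m)) < (1/2)^m \<and> r m < r (Suc m)"
    by (rule dependent_nat_choice[where P = "\<lambda>m k. measure P (A m k) < (1/2)^m" and Q = "\<lambda>m k k'. k < k'"])
       (use ex in blast)+
  then obtain r where r: "\<And>m. measure P (A m (r m)) < (1/2)^m" "\<And>m. r m < r (Suc m)" by blast
  have "strict_mono r" using r(2) by (simp add: strict_mono_Suc_iff)
  have summ: "summable (\<lambda>m. measure P (A m (r m)))"
    by (rule summable_comparison_test'[OF summable_geometric[of "1/2 :: real"]]) (use r(1) in \<open>auto intro: less_imp_le\<close>)
  have "AE \<omega> in P. eventually (\<lambda>m. \<omega> \<in> space P - A m (r m)) sequentially"
    by (rule borel_cantelli_AE1[OF _ _ summ]) (use A(1) emeasure_finite in \<open>auto simp: top.not_eq_extremum[symmetric]\<close>)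
  then have "AE \<omega> in P. (\<lambda>k. Y (r k) \<omega>) \<longlonglongrightarrow> 0"
  proof (rule AE_mp, intro AE_I2 impI)
    fix \<omega> assume "\<omega> \<in> space P" and ev: "eventually (\<lambda>m. \<omega> \<in> space P - A m (r m)) sequentially"
    have le: "eventually (\<lambda>m. Y (r m) \<omega> \<le> ennreal ((1/2)^m)) sequentially"
      using ev
    proof eventually_elim
      case (elim m)
      with A(2)[of m "r m"] show ?case by (auto simp: not_less[symmetric])
    qed
    have "(\<lambda>m. ennreal ((1/2)^m)) \<longlonglongrightarrow> ennreal 0"
      by (intro tendsto_ennrealI LIMSEQ_power_zero) simp
    then show "(\<lambda>k. Y (r k) \<omega>) \<longlonglongrightarrow> 0"
      by (intro tendsto_sandwich[OF _ le tendsto_const]) auto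
  qed
  with \<open>strict_mono r\<close> show thesis by (rule that)
qed

text \<open>
  Clamping time to \<open>[0, t]\<close> extends \<open>H\<close> from \<open>[0, t]\<close> to the whole line and so trades the restricted
  Borel algebra of progressive measurability for the ordinary product algebra.
\<close>

lemma progressively_measurable_clamp:
  assumes P: "filtered_prob_space P F" and H: "progressively_measurable F H" and "0 \<le> t"
  shows "(\<lambda>p. H (max 0 (min t (fst p))) (snd p)) \<in> borel_measurable (borel \<Otimes>\<^sub>M P)"
proof -
  interpret filtration "space P" F using P by (simp add: filtered_prob_space_def)
  have id: "(\<lambda>x. x) \<in> measurable P (F t)"
    using P by (intro measurableI) (auto simp: filtered_prob_space_def space_F dest: sets.sets_into_space)
  have 1: "(\<lambda>p. max 0 (min t (fst p))) \<in> measurable (borel \<Otimes>\<^sub>M P) (restrict_space borel {0..t})"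
    using \<open>0 \<le> t\<close> by (intro measurable_restrict_space2) auto
  have 2: "(\<lambda>p. snd p) \<in> measurable (borel \<Otimes>\<^sub>M P) (F t)"
    by (rule measurable_compose[OF measurable_snd id])
  have 3: "(\<lambda>p. (max 0 (min t (fst p)), snd p)) \<in> measurable (borel \<Otimes>\<^sub>M P) (restrict_space borel {0..t} \<Otimes>\<^sub>M F t)"
    using 1 2 by (rule measurable_Pair)
  have "(\<lambda>(s, \<omega>). H s \<omega>) \<in> borel_measurable (restrict_space borel {0..t} \<Otimes>\<^sub>M F t)"
    using H \<open>0 \<le> t\<close> by (auto simp: progressively_measurable_def)
  from measurable_compose[OF 3 this] show ?thesis by simp
qed

lemma progressively_measurable_sq:
  assumes P: "filtered_prob_space P F" and H: "progressively_measurable F H" and "0 \<le> s" "s \<le> t"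
  shows "(\<lambda>(r, \<omega>). ennreal ((H r \<omega>)\<^sup>2) * indicator {s..t} r) \<in> borel_measurable (lborel \<Otimes>\<^sub>M P)"
proof -
  have [measurable]: "(\<lambda>p. H (max 0 (min t (fst p))) (snd p)) \<in> borel_measurable (lborel \<Otimes>\<^sub>M P)"
    using progressively_measurable_clamp[OF P H, of t] assms(3,4)
    by (subst measurable_cong_sets[OF sets_pair_measure_cong[OF sets_lborel refl] refl]) auto
  have "(\<lambda>(r, \<omega>). ennreal ((H r \<omega>)\<^sup>2) * indicator {s..t} r)
      = (\<lambda>p. ennreal ((H (max 0 (min t (fst p))) (snd p))\<^sup>2) * indicator {s..t} (fst p))"
    using assms(3,4) by (auto simp: fun_eq_iff indicator_def)
  then show ?thesis by simp
qed

text \<open>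
  The substitute for the supermartingale property of the Ito integral. It survives the passage to the
  limit by Fatou's lemma, with no localization. Along the approximating simple processes \<open>h\<close> the
  compensator is controlled by \<open>h\<^sup>2 \<le> 2 H\<^sup>2 + 2 (h - H)\<^sup>2\<close>; this doubles the constant \<open>l\<^sup>2 / 2\<close>, which is
  harmless since the estimate is used for small \<open>l\<close>, where the compensator is of second order.
\<close>

lemma nn_integral_exp_ito_integral_le:
  assumes P: "filtered_prob_space P F" and W: "brownian_motion P F W"
    and I: "has_ito_integral P F W H I" and st: "0 \<le> s" "s < t"
  shows "(\<integral>\<^sup>+\<omega>. ennreal (exp (l * (I t \<omega> - I s \<omega>)
            - l\<^sup>2 * enn2real (\<integral>\<^sup>+r\<in>{s..t}. ennreal ((H r \<omega>)\<^sup>2) \<partial>lborel))) \<partial>P) \<le> 1"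
proof -
  interpret prob_space P using P by (simp add: filtered_prob_space_def)
  have prog: "progressively_measurable F H" using I by (simp add: has_ito_integral_def)
  have fin: "AE \<omega> in P. \<forall>T\<ge>0. (\<integral>\<^sup>+s\<in>{0..T}. ennreal ((H s \<omega>)\<^sup>2) \<partial>lborel) < \<infinity>"
    using I by (simp add: has_ito_integral_def)
  from I obtain n \<tau> \<xi> where simple: "\<And>k. simple_process P F (n k) (\<tau> k) (\<xi> k)"
    and L2: "\<And>T. 0 \<le> T \<Longrightarrow> tends_to_0_in_prob P
           (\<lambda>k \<omega>. \<integral>\<^sup>+s\<in>{0..T}. ennreal ((simple_value (n k) (\<tau> k) (\<xi> k) s \<omega> - H s \<omega>)\<^sup>2) \<partial>lborel)"
    and ucp: "\<And>T. 0 \<le> T \<Longrightarrow> tends_to_0_in_prob P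
           (\<lambda>k \<omega>. SUP t\<in>{0..T}. ennreal \<bar>simple_integral W (n k) (\<tau> k) (\<xi> k) t \<omega> - I t \<omega>\<bar>)"
    unfolding has_ito_integral_def by blast
  define h where "h k r \<omega> = simple_value (n k) (\<tau> k) (\<xi> k) r \<omega>" for k r \<omega>
  define M where "M k t \<omega> = simple_integral W (n k) (\<tau> k) (\<xi> k) t \<omega>" for k t \<omega>
  define e where "e k \<omega> = (\<integral>\<^sup>+r\<in>{0..t}. ennreal ((h k r \<omega> - H r \<omega>)\<^sup>2) \<partial>lborel)" for k \<omega>
  define d where "d k \<omega> = (SUP r\<in>{0..t}. ennreal \<bar>M k r \<omega> - I r \<omega>\<bar>)" for k \<omega>
  have "tends_to_0_in_prob P e" "tends_to_0_in_prob P d"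
    using L2[of t] ucp[of t] st unfolding e_def d_def h_def M_def by auto
  obtain r1 where r1: "strict_mono r1" "AE \<omega> in P. (\<lambda>k. e (r1 k) \<omega>) \<longlonglongrightarrow> 0"
    using tends_to_0_in_prob_subseq[OF prob_space_axioms \<open>tends_to_0_in_prob P e\<close>] .
  have "tends_to_0_in_prob P (\<lambda>k. d (r1 k))"
    unfolding tends_to_0_in_prob_def
  proof (intro allI impI)
    fix \<epsilon> :: ennreal assume "\<epsilon> > 0"
    with \<open>tends_to_0_in_prob P d\<close> obtain A where
      "\<forall>k. A k \<in> sets P \<and> {\<omega>\<in>space P. \<epsilon> < d k \<omega>} \<subseteq> A k" "(\<lambda>k. measure P (A k)) \<longlonglongrightarrow> 0"
      unfolding tends_to_0_in_prob_def by blast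
    then show "\<exists>A. (\<forall>k. A k \<in> sets P \<and> {\<omega>\<in>space P. \<epsilon> < d (r1 k) \<omega>} \<subseteq> A k) \<and> (\<lambda>k. measure P (A k)) \<longlonglongrightarrow> 0"
      using LIMSEQ_subseq_LIMSEQ[OF _ r1(1), of "\<lambda>k. measure P (A k)" 0]
      by (intro exI[of _ "\<lambda>k. A (r1 k)"]) (auto simp: o_def)
  qed
  then obtain r2 where r2: "strict_mono r2" "AE \<omega> in P. (\<lambda>k. d (r1 (r2 k)) \<omega>) \<longlonglongrightarrow> 0"
    using tends_to_0_in_prob_subseq[OF prob_space_axioms] by blast
  define r where "r k = r1 (r2 k)" for k
  have "\<forall>k. \<exists>Q. (\<forall>\<omega>. ennreal (Q \<omega>) \<le> (\<integral>\<^sup>+r\<in>{s..t}. ennreal ((h k r \<omega>)\<^sup>2) \<partial>lborel))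
      \<and> (\<lambda>\<omega>. ennreal (exp (l * (M k t \<omega> - M k s \<omega>) - l\<^sup>2 * Q \<omega> / 2))) \<in> borel_measurable P
      \<and> (\<integral>\<^sup>+\<omega>. ennreal (exp (l * (M k t \<omega> - M k s \<omega>) - l\<^sup>2 * Q \<omega> / 2)) \<partial>P) = 1"
    unfolding h_def M_def by (intro allI nn_integral_exp_simple_integral[OF P W simple st])
  from choice[OF this] obtain Q where QQ: "\<forall>k. (\<forall>\<omega>. ennreal (Q k \<omega>) \<le> (\<integral>\<^sup>+r\<in>{s..t}. ennreal ((h k r \<omega>)\<^sup>2) \<partial>lborel))
      \<and> (\<lambda>\<omega>. ennreal (exp (l * (M k t \<omega> - M k s \<omega>) - l\<^sup>2 * Q k \<omega> / 2))) \<in> borel_measurable P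
      \<and> (\<integral>\<^sup>+\<omega>. ennreal (exp (l * (M k t \<omega> - M k s \<omega>) - l\<^sup>2 * Q k \<omega> / 2)) \<partial>P) = 1" ..
  then have Q: "\<And>k \<omega>. ennreal (Q k \<omega>) \<le> (\<integral>\<^sup>+r\<in>{s..t}. ennreal ((h k r \<omega>)\<^sup>2) \<partial>lborel)"
      "\<And>k. (\<lambda>\<omega>. ennreal (exp (l * (M k t \<omega> - M k s \<omega>) - l\<^sup>2 * Q k \<omega> / 2))) \<in> borel_measurable P"
      "\<And>k. (\<integral>\<^sup>+\<omega>. ennreal (exp (l * (M k t \<omega> - M k s \<omega>) - l\<^sup>2 * Q k \<omega> / 2)) \<partial>P) = 1"
    by blast+
  define u where "u k \<omega> = ennreal (exp (l * (M k t \<omega> - M k s \<omega>) - l\<^sup>2 * Q k \<omega> / 2))" for k \<omega>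
  define q where "q \<omega> = (\<integral>\<^sup>+r\<in>{s..t}. ennreal ((H r \<omega>)\<^sup>2) \<partial>lborel)" for \<omega>
  have Qe: "ennreal (Q k \<omega>) \<le> 2 * q \<omega> + 2 * e k \<omega>" if "\<omega> \<in> space P" for k \<omega>
  proof -
    have "(\<lambda>p. ennreal ((H (fst p) (snd p))\<^sup>2) * indicator {s..t} (fst p)) \<in> borel_measurable (lborel \<Otimes>\<^sub>M P)"
      using progressively_measurable_sq[OF P prog, of s t] st by (simp add: case_prod_beta)
    from measurable_compose[OF measurable_Pair2'[OF that] this]
    have m1[measurable]: "(\<lambda>r. ennreal ((H r \<omega>)\<^sup>2) * indicator {s..t} r) \<in> borel_measurable lborel"
      by simp
    have "(\<lambda>r. H (max 0 (min t r)) \<omega>) \<in> borel_measurable borel"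
      using measurable_compose[OF measurable_Pair2'[OF that] progressively_measurable_clamp[OF P prog, of t]] st
      by simp
    moreover have "(\<lambda>r. h k r \<omega>) \<in> borel_measurable borel"
      unfolding h_def simple_value_def by measurable
    ultimately have "(\<lambda>r. ennreal ((h k r \<omega> - H (max 0 (min t r)) \<omega>)\<^sup>2) * indicator {0..t} r) \<in> borel_measurable borel"
      by measurable
    also have "(\<lambda>r. ennreal ((h k r \<omega> - H (max 0 (min t r)) \<omega>)\<^sup>2) * indicator {0..t} r)
        = (\<lambda>r. ennreal ((h k r \<omega> - H r \<omega>)\<^sup>2) * indicator {0..t} r)"
      by (auto simp: fun_eq_iff indicator_def)
    finally have m2[measurable]: "(\<lambda>r. ennreal ((h k r \<omega> - H r \<omega>)\<^sup>2) * indicator {0..t} r) \<in> borel_measurable borel" .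
    have "ennreal (Q k \<omega>) \<le> (\<integral>\<^sup>+r. 2 * (ennreal ((H r \<omega>)\<^sup>2) * indicator {s..t} r)
            + 2 * (ennreal ((h k r \<omega> - H r \<omega>)\<^sup>2) * indicator {0..t} r) \<partial>lborel)"
    proof (rule order_trans[OF Q(1)], rule nn_integral_mono)
      fix r
      have "(h k r \<omega>)\<^sup>2 \<le> 2 * (H r \<omega>)\<^sup>2 + 2 * (h k r \<omega> - H r \<omega>)\<^sup>2"
        using zero_le_power2[of "h k r \<omega> - 2 * H r \<omega>"] by (simp add: power2_eq_square algebra_simps)
      then have "ennreal ((h k r \<omega>)\<^sup>2) \<le> ennreal (2 * (H r \<omega>)\<^sup>2 + 2 * (h k r \<omega> - H r \<omega>)\<^sup>2)"
        by (rule ennreal_leI)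
      also have "\<dots> = 2 * ennreal ((H r \<omega>)\<^sup>2) + 2 * ennreal ((h k r \<omega> - H r \<omega>)\<^sup>2)"
        by (simp add: ennreal_plus ennreal_mult del: ennreal_plus[symmetric])
      finally show "ennreal ((h k r \<omega>)\<^sup>2) * indicator {s..t} r \<le> 2 * (ennreal ((H r \<omega>)\<^sup>2) * indicator {s..t} r)
            + 2 * (ennreal ((h k r \<omega> - H r \<omega>)\<^sup>2) * indicator {0..t} r)"
        using st by (auto simp: indicator_def)
    qed
    also have "\<dots> = 2 * q \<omega> + 2 * e k \<omega>"
      unfolding q_def e_def by (subst nn_integral_add) (auto simp: nn_integral_cmult)
    finally show ?thesis .
  qed
  have "AE \<omega> in P. ennreal (exp (l * (I t \<omega> - I s \<omega>) - l\<^sup>2 * enn2real (q \<omega>))) \<le> liminf (\<lambda>k. u (r k) \<omega>)"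
  proof -
    have "AE \<omega> in P. (\<lambda>k. e (r k) \<omega>) \<longlonglongrightarrow> 0"
      using r1(2)
    proof eventually_elim
      case (elim \<omega>)
      from LIMSEQ_subseq_LIMSEQ[OF this r2(1)] show ?case by (simp add: o_def r_def)
    qed
    with r2(2) fin show ?thesis
    proof (rule AE_mp[OF AE_conjI[OF AE_conjI]], intro AE_I2 impI)
      fix \<omega> assume \<omega>: "\<omega> \<in> space P" and as: "((\<lambda>k. d (r1 (r2 k)) \<omega>) \<longlonglongrightarrow> 0 \<and>
          (\<forall>T\<ge>0. (\<integral>\<^sup>+s\<in>{0..T}. ennreal ((H s \<omega>)\<^sup>2) \<partial>lborel) < \<infinity>)) \<and> (\<lambda>k. e (r k) \<omega>) \<longlonglongrightarrow> 0"
      then have d0: "(\<lambda>k. d (r k) \<omega>) \<longlonglongrightarrow> 0" and e0: "(\<lambda>k. e (r k) \<omega>) \<longlonglongrightarrow> 0" by (auto simp: r_def)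
      have "q \<omega> \<le> (\<integral>\<^sup>+s\<in>{0..t}. ennreal ((H s \<omega>)\<^sup>2) \<partial>lborel)"
        unfolding q_def using st by (intro nn_integral_mono) (auto simp: indicator_def)
      also have "\<dots> < \<infinity>" using as st by simp
      finally have q: "q \<omega> < \<infinity>" .
      have MI: "(\<lambda>k. M (r k) p \<omega>) \<longlonglongrightarrow> I p \<omega>" if "p \<in> {0..t}" for p
      proof -
        have "(\<lambda>k. ennreal \<bar>M (r k) p \<omega> - I p \<omega>\<bar>) \<longlonglongrightarrow> ennreal 0"
        proof (rule tendsto_sandwich[OF _ _ tendsto_const])
          show "\<forall>\<^sub>F k in sequentially. ennreal \<bar>M (r k) p \<omega> - I p \<omega>\<bar> \<le> d (r k) \<omega>"
            unfolding d_def using that by (auto intro!: always_eventually SUP_upper2[where i=p])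
        qed (use d0 in auto)
        then have "(\<lambda>k. \<bar>M (r k) p \<omega> - I p \<omega>\<bar>) \<longlonglongrightarrow> 0"
          by (subst (asm) tendsto_ennreal_iff) auto
        then show ?thesis by (simp add: tendsto_rabs_zero_iff LIM_zero_iff)
      qed
      have e0': "(\<lambda>k. enn2real (e (r k) \<omega>)) \<longlonglongrightarrow> 0"
        by (rule tendsto_enn2real) (use e0 in auto)
      let ?v = "\<lambda>k. ennreal (exp (l * (M (r k) t \<omega> - M (r k) s \<omega>) - l\<^sup>2 * (enn2real (q \<omega>) + enn2real (e (r k) \<omega>))))"
      have "?v \<longlonglongrightarrow> ennreal (exp (l * (I t \<omega> - I s \<omega>) - l\<^sup>2 * (enn2real (q \<omega>) + 0)))"
        using st by (intro tendsto_ennrealI tendsto_intros e0' MI) auto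
      from lim_imp_Liminf[OF sequentially_bot this]
      have "ennreal (exp (l * (I t \<omega> - I s \<omega>) - l\<^sup>2 * enn2real (q \<omega>))) = liminf ?v"
        by simp
      also have "\<dots> \<le> liminf (\<lambda>k. u (r k) \<omega>)"
      proof (rule Liminf_mono)
        have "\<forall>\<^sub>F k in sequentially. e (r k) \<omega> < \<infinity>"
          using e0 by (rule order_tendstoD) simp
        then show "\<forall>\<^sub>F k in sequentially. ?v k \<le> u (r k) \<omega>"
        proof eventually_elim
          case (elim k)
          have "ennreal (Q (r k) \<omega>) \<le> 2 * ennreal (enn2real (q \<omega>)) + 2 * ennreal (enn2real (e (r k) \<omega>))"
            using Qe[OF \<omega>, of "r k"] q elim by simp
          also have "\<dots> = ennreal (2 * enn2real (q \<omega>) + 2 * enn2real (e (r k) \<omega>))"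
            by (simp add: ennreal_plus ennreal_mult del: ennreal_plus[symmetric])
          finally have "Q (r k) \<omega> \<le> 2 * enn2real (q \<omega>) + 2 * enn2real (e (r k) \<omega>)"
            by (subst (asm) ennreal_le_iff) auto
          then have "l\<^sup>2 * Q (r k) \<omega> \<le> l\<^sup>2 * (2 * enn2real (q \<omega>) + 2 * enn2real (e (r k) \<omega>))"
            by (rule mult_left_mono) simp
          then show ?case
            unfolding u_def by (intro ennreal_leI) (simp add: algebra_simps)
        qed
      qed
      finally show "ennreal (exp (l * (I t \<omega> - I s \<omega>) - l\<^sup>2 * enn2real (q \<omega>))) \<le> liminf (\<lambda>k. u (r k) \<omega>)" .
    qed
  qed
  then have "(\<integral>\<^sup>+\<omega>. ennreal (exp (l * (I t \<omega> - I s \<omega>) - l\<^sup>2 * enn2real (q \<omega>))) \<partial>P)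
      \<le> (\<integral>\<^sup>+\<omega>. liminf (\<lambda>k. u (r k) \<omega>) \<partial>P)"
    by (rule nn_integral_mono_AE)
  also have "\<dots> \<le> liminf (\<lambda>k. \<integral>\<^sup>+\<omega>. u (r k) \<omega> \<partial>P)"
    using Q(2) by (intro nn_integral_liminf) (simp add: u_def)
  also have "\<dots> = 1"
    using Q(3) by (simp add: u_def Liminf_const)
  finally show ?thesis unfolding q_def .
qed

section \<open>Sign and mean of the jump process\<close>

text \<open>
  Small jumps are summable by the definition of a Levy measure of finite variation, large ones by
  assumption.
\<close>

lemma levy_measure_mean_finite:
  assumes \<nu>: "positive_levy_measure \<nu>" and big: "(\<integral>\<^sup>+\<xi>\<in>{1<..}. ennreal \<xi> \<partial>\<nu>) < \<infinity>"
  shows "(\<integral>\<^sup>+\<xi>\<in>{0<..}. ennreal \<xi> \<partial>\<nu>) < \<infinity>"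
proof -
  have [measurable_cong]: "sets \<nu> = sets borel" using \<nu> by (simp add: positive_levy_measure_def)
  have "(\<integral>\<^sup>+\<xi>\<in>{0<..}. ennreal \<xi> \<partial>\<nu>)
     \<le> (\<integral>\<^sup>+\<xi>. ennreal (min \<xi> 1) * indicator {0<..} \<xi> + ennreal \<xi> * indicator {1<..} \<xi> \<partial>\<nu>)"
    by (intro nn_integral_mono) (auto simp: indicator_def min_def)
  also have "\<dots> = (\<integral>\<^sup>+\<xi>\<in>{0<..}. ennreal (min \<xi> 1) \<partial>\<nu>) + (\<integral>\<^sup>+\<xi>\<in>{1<..}. ennreal \<xi> \<partial>\<nu>)"
    by (rule nn_integral_add) measurable
  also have "\<dots> < \<infinity>"
    using \<nu> big by (simp add: positive_levy_measure_def)
  finally show ?thesis .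
qed

text \<open>
  Integrates \<open>- l \<xi> \<le> exp (- l \<xi>) - 1 \<le> 0\<close> over the jump sizes.
\<close>

lemma levy_laplace_exponent_bounds:
  assumes \<nu>: "positive_levy_measure \<nu>" and fin: "(\<integral>\<^sup>+\<xi>\<in>{0<..}. ennreal \<xi> \<partial>\<nu>) < \<infinity>" and "0 \<le> l"
  defines "K \<equiv> (LINT \<xi>:{0<..}|\<nu>. exp (- l * \<xi>) - 1)"
  shows "- l * enn2real (\<integral>\<^sup>+\<xi>\<in>{0<..}. ennreal \<xi> \<partial>\<nu>) \<le> K" "K \<le> 0"
proof -
  have [measurable_cong]: "sets \<nu> = sets borel" using \<nu> by (simp add: positive_levy_measure_def)
  have int: "integrable \<nu> (\<lambda>\<xi>. indicator {0<..} \<xi> * \<xi>)"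
  proof (rule integrableI_nonneg)
    show "(\<integral>\<^sup>+ \<xi>. ennreal (indicator {0<..} \<xi> * \<xi>) \<partial>\<nu>) < \<infinity>"
      using fin by (rule order_le_less_trans[rotated]) (auto intro!: nn_integral_mono simp: indicator_def)
  qed (auto simp: indicator_def)
  have m: "enn2real (\<integral>\<^sup>+\<xi>\<in>{0<..}. ennreal \<xi> \<partial>\<nu>) = (\<integral>\<xi>. indicator {0<..} \<xi> * \<xi> \<partial>\<nu>)"
    by (subst integral_eq_nn_integral)
       (auto simp: indicator_def intro!: arg_cong[where f=enn2real] nn_integral_cong)
  have b: "indicator {0<..} \<xi> * (- l * \<xi>) \<le> indicator {0<..} \<xi> * (exp (- l * \<xi>) - 1)"
      "indicator {0<..} \<xi> * (exp (- l * \<xi>) - 1) \<le> 0" for \<xi> :: real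
    using exp_ge_add_one_self[of "- l * \<xi>"] \<open>0 \<le> l\<close> by (auto simp: indicator_def)
  have i1: "integrable \<nu> (\<lambda>\<xi>. indicator {0<..} \<xi> * (- l * \<xi>))"
    using integrable_mult_right[OF int, of "- l"] by (simp add: algebra_simps)
  have i2: "integrable \<nu> (\<lambda>\<xi>. indicator {0<..} \<xi> * (exp (- l * \<xi>) - 1))"
    using i1
  proof (rule Bochner_Integration.integrable_bound)
    show "AE \<xi> in \<nu>. norm (indicator {0<..} \<xi> * (exp (- l * \<xi>) - 1)) \<le> norm (indicator {0<..} \<xi> * (- l * \<xi>))"
      using b by (intro AE_I2) (metis abs_le_iff abs_of_nonpos order_trans real_norm_def neg_le_iff_le)
  qed measurable
  have K: "K = (\<integral>\<xi>. indicator {0<..} \<xi> * (exp (- l * \<xi>) - 1) \<partial>\<nu>)"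
    by (simp add: K_def set_lebesgue_integral_def)
  have "- l * enn2real (\<integral>\<^sup>+\<xi>\<in>{0<..}. ennreal \<xi> \<partial>\<nu>) = (\<integral>\<xi>. indicator {0<..} \<xi> * (- l * \<xi>) \<partial>\<nu>)"
    unfolding m by (subst integral_mult_right_zero[symmetric]) (simp add: algebra_simps)
  also have "\<dots> \<le> K" unfolding K by (rule integral_mono[OF i1 i2 b(1)])
  finally show "- l * enn2real (\<integral>\<^sup>+\<xi>\<in>{0<..}. ennreal \<xi> \<partial>\<nu>) \<le> K" .
  show "K \<le> 0" unfolding K using integral_mono[OF i2, of "\<lambda>_. 0"] b(2) by simp
qed

text \<open>
  Negative values of \<open>Z\<close> would make \<open>E[exp (- n Z)]\<close> grow with \<open>n\<close>: it dominates \<open>n E[Z\<^sup>-]\<close>.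
\<close>

lemma (in prob_space) AE_nonneg_of_laplace:
  assumes Z: "Z \<in> borel_measurable M"
    and lap: "\<And>n::nat. (\<integral>\<^sup>+\<omega>. ennreal (exp (- real n * Z \<omega>)) \<partial>M) \<le> 1"
  shows "AE \<omega> in M. 0 \<le> Z \<omega>"
proof -
  have [measurable]: "Z \<in> borel_measurable M" by fact
  let ?N = "\<integral>\<^sup>+\<omega>. ennreal (- Z \<omega>) \<partial>M"
  have b: "of_nat n * ?N \<le> 1" for n
  proof -
    have "of_nat n * ?N = (\<integral>\<^sup>+\<omega>. of_nat n * ennreal (- Z \<omega>) \<partial>M)"
      by (rule nn_integral_cmult[symmetric]) measurable
    also have "\<dots> \<le> (\<integral>\<^sup>+\<omega>. ennreal (exp (- real n * Z \<omega>)) \<partial>M)"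
    proof (rule nn_integral_mono)
      fix \<omega>
      have "real n * - Z \<omega> \<le> exp (- real n * Z \<omega>)"
        using exp_ge_add_one_self[of "- real n * Z \<omega>"] by linarith
      then show "of_nat n * ennreal (- Z \<omega>) \<le> ennreal (exp (- real n * Z \<omega>))"
        by (metis ennreal_leI ennreal_mult' ennreal_of_nat_eq_real_of_nat of_nat_0_le_iff)
    qed
    also have "\<dots> \<le> 1" by (rule lap)
    finally show ?thesis .
  qed
  have "?N = 0"
  proof (cases "?N")
    case (real x)
    have "real n * x \<le> 1" for n
      using b[of n] real by (metis ennreal_le_1 ennreal_mult' ennreal_of_nat_eq_real_of_nat of_nat_0_le_iff)
    with real(2) have "x = 0"
      by (metis ex_less_of_nat_mult not_le order.order_iff_strict real(1))
    with real show ?thesis by simp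
  next
    case top
    then show ?thesis using b[of 1] by (simp add: top_unique)
  qed
  then have "AE \<omega> in M. ennreal (- Z \<omega>) = 0"
    by (subst (asm) nn_integral_0_iff_AE) measurable
  then show ?thesis by eventually_elim (simp add: ennreal_eq_0_iff)
qed

text \<open>
  The mean is minus the slope of the Laplace transform at 0. The difference quotients
  \<open>(1 - exp (- l Z)) / l\<close> have mean at most \<open>(1 - exp (- l C)) / l \<le> C\<close>, and Fatou's lemma with
  \<open>l = 1 / (n + 1)\<close> gives the bound for \<open>Z\<close>.
\<close>

lemma (in prob_space) nn_integral_le_of_laplace:
  assumes Z: "Z \<in> borel_measurable M" and pos: "AE \<omega> in M. 0 \<le> Z \<omega>" and "0 \<le> C"
    and lap: "\<And>l. 0 \<le> l \<Longrightarrow> ennreal (exp (- l * C)) \<le> (\<integral>\<^sup>+\<omega>. ennreal (exp (- l * Z \<omega>)) \<partial>M)"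
  shows "(\<integral>\<^sup>+\<omega>. ennreal (Z \<omega>) \<partial>M) \<le> ennreal C"
proof -
  have [measurable]: "Z \<in> borel_measurable M" by fact
  define g where "g n \<omega> = ennreal (real (Suc n) * (1 - exp (- (1 / real (Suc n)) * Z \<omega>)))" for n \<omega>
  have lim: "(\<lambda>n. g n \<omega>) \<longlonglongrightarrow> ennreal (Z \<omega>)" for \<omega>
  proof -
    have "((\<lambda>h. (exp (- h * Z \<omega>) - 1) / h) \<longlongrightarrow> - Z \<omega>) (at 0)"
    proof -
      have "((\<lambda>h. exp (- h * Z \<omega>)) has_real_derivative - Z \<omega>) (at 0)"
        by (auto intro!: derivative_eq_intros)
      from DERIV_D[OF this] show ?thesis by simp
    qed
    moreover have "filterlim (\<lambda>n. 1 / real (Suc n)) (at 0) sequentially"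
      using LIMSEQ_inverse_real_of_nat by (auto simp: filterlim_at inverse_eq_divide)
    ultimately have "(\<lambda>n. (exp (- (1 / real (Suc n)) * Z \<omega>) - 1) / (1 / real (Suc n))) \<longlonglongrightarrow> - Z \<omega>"
      by (rule filterlim_compose)
    from tendsto_minus[OF this]
    have "(\<lambda>n. real (Suc n) * (1 - exp (- (1 / real (Suc n)) * Z \<omega>))) \<longlonglongrightarrow> Z \<omega>"
      by (simp add: algebra_simps)
    then show ?thesis unfolding g_def by (rule tendsto_ennrealI)
  qed
  have int: "(\<integral>\<^sup>+\<omega>. g n \<omega> \<partial>M) \<le> ennreal C" for n
  proof -
    define l where "l = 1 / real (Suc n)"
    have l: "0 < l" "real (Suc n) = 1 / l" by (auto simp: l_def)
    let ?e = "\<lambda>\<omega>. ennreal (exp (- l * Z \<omega>))"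
    have "(\<integral>\<^sup>+\<omega>. ennreal l * g n \<omega> \<partial>M) + ennreal (exp (- l * C)) \<le> (\<integral>\<^sup>+\<omega>. ennreal l * g n \<omega> \<partial>M) + (\<integral>\<^sup>+\<omega>. ?e \<omega> \<partial>M)"
      using lap[of l] l by (intro add_left_mono) simp
    also have "\<dots> = (\<integral>\<^sup>+\<omega>. ennreal l * g n \<omega> + ?e \<omega> \<partial>M)"
      unfolding g_def by (rule nn_integral_add[symmetric]) measurable
    also have "\<dots> = (\<integral>\<^sup>+\<omega>. 1 \<partial>M)"
    proof (rule nn_integral_cong_AE)
      show "AE \<omega> in M. ennreal l * g n \<omega> + ?e \<omega> = 1"
        using pos
      proof eventually_elim
        case (elim \<omega>)
        then have "0 \<le> l * Z \<omega>" using l by simp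
        then have "0 \<le> 1 - exp (- l * Z \<omega>)" by simp
        then have "ennreal l * g n \<omega> + ?e \<omega> = ennreal (l * (1 / l * (1 - exp (- l * Z \<omega>))) + exp (- l * Z \<omega>))"
          using l unfolding g_def l(2) l_def[symmetric]
          by (simp add: ennreal_mult'[symmetric] ennreal_plus[symmetric] del: ennreal_plus)
        also have "\<dots> = 1" using l by simp
        finally show ?case .
      qed
    qed
    also have "\<dots> = 1" by (simp add: emeasure_space_1)
    finally have *: "ennreal l * (\<integral>\<^sup>+\<omega>. g n \<omega> \<partial>M) + ennreal (exp (- l * C)) \<le> 1"
      by (subst (asm) nn_integral_cmult) (simp_all add: g_def[abs_def])
    show ?thesis
    proof (cases "\<integral>\<^sup>+\<omega>. g n \<omega> \<partial>M")
      case (real x)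
      have "l * x + exp (- l * C) \<le> 1"
        using * real l by (simp add: ennreal_mult'[symmetric] ennreal_plus[symmetric] del: ennreal_plus)
      moreover have "1 - l * C \<le> exp (- l * C)"
        using exp_ge_add_one_self[of "- l * C"] by simp
      ultimately have "l * x \<le> l * C" by linarith
      with l have "x \<le> C" by simp
      with real show ?thesis by (simp add: ennreal_leI)
    next
      case top
      then show ?thesis using * l by (simp add: ennreal_mult_top top_unique)
    qed
  qed
  have "(\<integral>\<^sup>+\<omega>. ennreal (Z \<omega>) \<partial>M) = (\<integral>\<^sup>+\<omega>. liminf (\<lambda>n. g n \<omega>) \<partial>M)"
    using lim_imp_Liminf[OF _ lim] by (intro nn_integral_cong) simp
  also have "\<dots> \<le> liminf (\<lambda>n. \<integral>\<^sup>+\<omega>. g n \<omega> \<partial>M)"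
    by (rule nn_integral_liminf) (unfold g_def, measurable)
  also have "\<dots> \<le> liminf (\<lambda>n::nat. ennreal C)"
    using int by (intro Liminf_mono) auto
  also have "\<dots> = ennreal C" by (simp add: Liminf_const)
  finally show ?thesis .
qed

text \<open>
  The law of an increment is known only through its Laplace transform, from which both the sign and
  the mean are read off.
\<close>

lemma levy_increment_nonneg_mean:
  assumes P: "filtered_prob_space P F" and \<nu>: "positive_levy_measure \<nu>"
    and J: "pure_jump_levy_process P F \<nu> J" and fin: "(\<integral>\<^sup>+\<xi>\<in>{0<..}. ennreal \<xi> \<partial>\<nu>) < \<infinity>"
    and st: "0 \<le> s" "s < t"
  shows "AE \<omega> in P. 0 \<le> J t \<omega> - J s \<omega>"
    and "(\<integral>\<^sup>+\<omega>. ennreal (J t \<omega> - J s \<omega>) \<partial>P) \<le> ennreal ((t - s) * enn2real (\<integral>\<^sup>+\<xi>\<in>{0<..}. ennreal \<xi> \<partial>\<nu>))"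
proof -
  interpret prob_space P using P by (simp add: filtered_prob_space_def)
  interpret filtration "space P" F using P by (simp add: filtered_prob_space_def)
  define m where "m = enn2real (\<integral>\<^sup>+\<xi>\<in>{0<..}. ennreal \<xi> \<partial>\<nu>)"
  have J_meas[measurable]: "J r \<in> borel_measurable P" if "0 \<le> r" for r
  proof -
    have "J r \<in> borel_measurable (F r)"
      using J that by (auto simp: pure_jump_levy_process_def adapted_def)
    moreover have "sets (F r) \<subseteq> sets P" using P by (simp add: filtered_prob_space_def)
    ultimately show ?thesis
      using measurable_mono[of borel borel "F r" P] by (auto simp: space_F)
  qed
  define Z where "Z \<omega> = J t \<omega> - J s \<omega>" for \<omega>
  have Z[measurable]: "Z \<in> borel_measurable P" unfolding Z_def using st by simp
  have lap: "(\<integral>\<^sup>+\<omega>. ennreal (exp (- l * Z \<omega>)) \<partial>P) = ennreal (exp ((t - s) * (LINT \<xi>:{0<..}|\<nu>. exp (- l * \<xi>) - 1)))"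
    if "0 \<le> l" for l
  proof -
    have [measurable]: "J (t - s) \<in> borel_measurable P" using st by simp
    have "(\<integral>\<omega>. exp (complex_of_real (- l) * of_real (J (t - s) \<omega>)) \<partial>P)
        = exp (of_real (t - s) * set_lebesgue_integral \<nu> {0<..} (\<lambda>\<xi>. exp (complex_of_real (- l) * of_real \<xi>) - 1))"
    proof -
      have "0 \<le> t - s" "Re (complex_of_real (- l)) \<le> 0" using st that by auto
      then show ?thesis using J unfolding pure_jump_levy_process_def by blast
    qed
    also have "(\<lambda>\<omega>. exp (complex_of_real (- l) * of_real (J (t - s) \<omega>)))
        = (\<lambda>\<omega>. complex_of_real (exp (- l * J (t - s) \<omega>)))"
      by (simp add: exp_of_real[symmetric])
    also have "(\<lambda>\<xi>. exp (complex_of_real (- l) * of_real \<xi>) - 1) = (\<lambda>\<xi>. complex_of_real (exp (- l * \<xi>) - 1))"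
      by (simp add: exp_of_real[symmetric])
    finally have "complex_of_real (\<integral>\<omega>. exp (- l * J (t - s) \<omega>) \<partial>P)
        = complex_of_real (exp ((t - s) * (LINT \<xi>:{0<..}|\<nu>. exp (- l * \<xi>) - 1)))"
      unfolding integral_complex_of_real set_integral_complex_of_real by (simp add: exp_of_real[symmetric])
    then have eq: "(\<integral>\<omega>. exp (- l * J (t - s) \<omega>) \<partial>P) = exp ((t - s) * (LINT \<xi>:{0<..}|\<nu>. exp (- l * \<xi>) - 1))"
      by (simp only: of_real_eq_iff)
    \<comment> \<open>A Bochner integral with a nonzero value can only come from an integrable function.\<close>
    then have "integrable P (\<lambda>\<omega>. exp (- l * J (t - s) \<omega>))"
      by (metis exp_not_eq_zero not_integrable_integral_eq)
    then have "(\<integral>\<^sup>+\<omega>. ennreal (exp (- l * J (t - s) \<omega>)) \<partial>P) = ennreal (\<integral>\<omega>. exp (- l * J (t - s) \<omega>) \<partial>P)"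
      by (rule nn_integral_eq_integral) simp
    moreover have "(\<integral>\<^sup>+\<omega>. ennreal (exp (- l * J (t - s) \<omega>)) \<partial>P) = (\<integral>\<^sup>+z. ennreal (exp (- l * z)) \<partial>distr P borel (J (t - s)))"
      by (simp add: nn_integral_distr)
    moreover have "distr P borel (J (t - s)) = distr P borel Z"
      using J st unfolding pure_jump_levy_process_def Z_def by auto
    moreover have "(\<integral>\<^sup>+z. ennreal (exp (- l * z)) \<partial>distr P borel Z) = (\<integral>\<^sup>+\<omega>. ennreal (exp (- l * Z \<omega>)) \<partial>P)"
      by (simp add: nn_integral_distr)
    ultimately show ?thesis using eq by simp
  qed
  have "AE \<omega> in P. 0 \<le> Z \<omega>"
  proof (rule AE_nonneg_of_laplace[OF Z])
    fix n :: nat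
    show "(\<integral>\<^sup>+\<omega>. ennreal (exp (- real n * Z \<omega>)) \<partial>P) \<le> 1"
      using levy_laplace_exponent_bounds(2)[OF \<nu> fin, of "real n"] st
      by (subst lap) (auto simp: mult_nonneg_nonpos)
  qed
  then show "AE \<omega> in P. 0 \<le> J t \<omega> - J s \<omega>" by (simp add: Z_def)
  have "(\<integral>\<^sup>+\<omega>. ennreal (Z \<omega>) \<partial>P) \<le> ennreal ((t - s) * m)"
  proof (rule nn_integral_le_of_laplace[OF Z \<open>AE \<omega> in P. 0 \<le> Z \<omega>\<close>])
    show "0 \<le> (t - s) * m" using st by (simp add: m_def)
    fix l :: real assume "0 \<le> l"
    have "(t - s) * (- l * m) \<le> (t - s) * (LINT \<xi>:{0<..}|\<nu>. exp (- l * \<xi>) - 1)"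
      using levy_laplace_exponent_bounds(1)[OF \<nu> fin \<open>0 \<le> l\<close>] st by (intro mult_left_mono) (auto simp: m_def)
    then show "ennreal (exp (- l * ((t - s) * m))) \<le> (\<integral>\<^sup>+\<omega>. ennreal (exp (- l * Z \<omega>)) \<partial>P)"
      unfolding lap[OF \<open>0 \<le> l\<close>] by (intro ennreal_leI) (simp add: algebra_simps)
  qed
  then show "(\<integral>\<^sup>+\<omega>. ennreal (J t \<omega> - J s \<omega>) \<partial>P) \<le> ennreal ((t - s) * enn2real (\<integral>\<^sup>+\<xi>\<in>{0<..}. ennreal \<xi> \<partial>\<nu>))"
    by (simp add: Z_def m_def)
qed

section \<open>The mean of the JCIR process\<close>

text \<open>
  The occupation integral \<open>\<integral> x dr\<close> is rewritten as a nonnegative integral of \<open>h\<^sup>2\<close>, the form in which it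
  also appears as the compensator of the Ito integral.
\<close>

lemma affine_drift_increment:
  fixes x h :: "real \<Rightarrow> real"
  assumes int: "set_integrable lborel {0..t} (\<lambda>r. a * (\<theta> - x r))" and "0 < a"
    and x: "\<And>r. 0 \<le> r \<Longrightarrow> x r = (h r)\<^sup>2" and st: "0 \<le> s" "s \<le> t"
  shows "(LBINT r:{0..t}. a * (\<theta> - x r)) - (LBINT r:{0..s}. a * (\<theta> - x r))
      = a * \<theta> * (t - s) - a * enn2real (\<integral>\<^sup>+r\<in>{s..t}. ennreal ((h r)\<^sup>2) \<partial>lborel)"
proof -
  have sub: "set_integrable lborel A (\<lambda>r. a * (\<theta> - x r))" if "A \<subseteq> {0..t}" "A \<in> sets borel" for A
    using set_integrable_subset[OF int _ that(1)] that(2) by simp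
  have split: "{0..t} = {0..s} \<union> {s<..t}" using st by auto
  have "(LBINT r:{0..t}. a * (\<theta> - x r))
      = (LBINT r:{0..s}. a * (\<theta> - x r)) + (LBINT r:{s<..t}. a * (\<theta> - x r))"
    unfolding split using st by (intro set_integral_Un sub) auto
  moreover have "(LBINT r:{s<..t}. a * (\<theta> - x r)) = a * \<theta> * (t - s) - a * (LBINT r:{s<..t}. x r)"
  proof -
    have c: "set_integrable lborel {s<..t} (\<lambda>r. c)" for c :: real
      unfolding set_integrable_def real_scaleR_def
      using st by (intro integrable_mult_left integrable_real_indicator) auto
    have i: "set_integrable lborel {s<..t} (\<lambda>r. a * (\<theta> - x r))" using st by (intro sub) auto
    have "set_integrable lborel {s<..t} (\<lambda>r. (1 / a) * (a * (\<theta> - x r)))"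
      using i by (intro set_integrable_mult_right) simp
    from set_integral_diff(1)[OF c[of \<theta>] this]
    have X: "set_integrable lborel {s<..t} x" using \<open>0 < a\<close> by simp
    have "(LBINT r:{s<..t}. a * (\<theta> - x r)) = a * ((LBINT r:{s<..t}. \<theta>) - (LBINT r:{s<..t}. x r))"
      using set_integral_diff(2)[OF c[of \<theta>] X] by simp
    also have "(LBINT r:{s<..t}. \<theta>) = \<theta> * (t - s)"
      using st by (simp add: set_lebesgue_integral_def)
    finally show ?thesis by (simp add: algebra_simps)
  qed
  moreover have "(LBINT r:{s<..t}. x r) = enn2real (\<integral>\<^sup>+r\<in>{s..t}. ennreal ((h r)\<^sup>2) \<partial>lborel)"
  proof -
    have i: "set_integrable lborel {s<..t} (\<lambda>r. a * (\<theta> - x r))" using st by (intro sub) auto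
    then have "set_borel_measurable lborel {s<..t} (\<lambda>r. a * (\<theta> - x r))"
      by (auto simp: set_integrable_def set_borel_measurable_def)
    then have "(\<lambda>r. \<theta> * indicator {s<..t} r - (1 / a) * (indicator {s<..t} r *\<^sub>R (a * (\<theta> - x r)))) \<in> borel_measurable borel"
      unfolding set_borel_measurable_def by measurable
    also have "(\<lambda>r. \<theta> * indicator {s<..t} r - (1 / a) * (indicator {s<..t} r *\<^sub>R (a * (\<theta> - x r))))
       = (\<lambda>r. indicator {s<..t} r *\<^sub>R x r)"
      using \<open>0 < a\<close> by (auto simp: fun_eq_iff indicator_def)
    finally have "(LBINT r:{s<..t}. x r) = enn2real (\<integral>\<^sup>+r. ennreal (indicator {s<..t} r *\<^sub>R x r) \<partial>lborel)"
      unfolding set_lebesgue_integral_def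
      using st x by (intro integral_eq_nn_integral) (auto simp: indicator_def)
    also have "(\<integral>\<^sup>+r. ennreal (indicator {s<..t} r *\<^sub>R x r) \<partial>lborel)
        = (\<integral>\<^sup>+r\<in>{s..t}. ennreal ((h r)\<^sup>2) \<partial>lborel)"
      using AE_lborel_singleton[of s] st
      by (intro nn_integral_cong_AE) (auto elim!: eventually_mono simp: indicator_def x)
    finally show ?thesis .
  qed
  ultimately show ?thesis by simp
qed

text \<open>
  The heart of the proof. With \<open>Y = I t - I s\<close> and \<open>q = \<integral>\<^bsub>s\<^esub>\<^bsup>t\<^esup> X dr\<close>, the inequality
  \<open>1 + l Y - l\<^sup>2 q \<le> exp (l Y - l\<^sup>2 q)\<close> and the mean bound for the exponential give, after multiplication by
  \<open>\<sigma> / l\<close>, that \<open>\<sigma> Y\<close> has mean at most \<open>\<sigma> l E[q]\<close>. The equation expresses \<open>\<sigma> Y\<close> by \<open>X\<close>, \<open>J\<close> and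
  \<open>a q\<close>, so that this error only lowers the mean-reversion rate from \<open>a\<close> to \<open>b = a - \<sigma> l\<close>, and \<open>b\<close> may be
  taken as close to \<open>a\<close> as desired.

  All terms are arranged so as to be nonnegative, which makes the integrability of \<open>X\<close> a consequence
  of the inequality.
\<close>

lemma jcir_mean_step:
  fixes X :: "real \<Rightarrow> 'w \<Rightarrow> real"
  assumes "0 < \<sigma>" and "0 \<le> \<theta>" and P: "filtered_prob_space P F"
    and \<nu>: "positive_levy_measure \<nu>" and W: "brownian_motion P F W"
    and J: "pure_jump_levy_process P F \<nu> J"
    and X: "jcir_process P F W J a \<theta> \<sigma> x X"
    and fin: "(\<integral>\<^sup>+\<xi>\<in>{0<..}. ennreal \<xi> \<partial>\<nu>) < \<infinity>"
    and st: "0 \<le> s" "s < t" and b: "0 < b" "b < a"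
  defines "f \<equiv> \<lambda>r. \<integral>\<^sup>+\<omega>. ennreal (X r \<omega>) \<partial>P"
    and "c \<equiv> a * \<theta> + enn2real (\<integral>\<^sup>+\<xi>\<in>{0<..}. ennreal \<xi> \<partial>\<nu>)"
  shows "f t + ennreal b * (\<integral>\<^sup>+r\<in>{s..t}. f r \<partial>lborel) \<le> f s + ennreal (c * (t - s))"
proof -
  interpret prob_space P using P by (simp add: filtered_prob_space_def)
  interpret filtration "space P" F using P by (simp add: filtered_prob_space_def)
  interpret pair_sigma_finite lborel P by standard
  have F_to_P: "Y \<in> borel_measurable P" if "Y \<in> borel_measurable (F r)" for r and Y :: "'w \<Rightarrow> real"
    using that measurable_mono[of borel borel "F r" P] P
    by (auto simp: space_F filtered_prob_space_def)
  define m where "m = enn2real (\<integral>\<^sup>+\<xi>\<in>{0<..}. ennreal \<xi> \<partial>\<nu>)"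
  define l where "l = (a - b) / \<sigma>"
  have l: "0 < l" "a - \<sigma> * l = b" using b \<open>0 < \<sigma>\<close> by (auto simp: l_def)
  obtain H I where H: "AE \<omega> in P. \<forall>s\<ge>0. H s \<omega> = sqrt (X s \<omega>)"
    and I: "has_ito_integral P F W H I"
    and sde: "AE \<omega> in P. \<forall>t\<ge>0.
           X t \<omega> = x + (LBINT s:{0..t}. a * (\<theta> - X s \<omega>)) + \<sigma> * I t \<omega> + J t \<omega>"
    using X unfolding jcir_process_def by blast
  have nonneg: "AE \<omega> in P. \<forall>t\<ge>0. 0 \<le> X t \<omega>"
    and drift: "AE \<omega> in P. \<forall>t\<ge>0. set_integrable lborel {0..t} (\<lambda>s. a * (\<theta> - X s \<omega>))"
    using X by (auto simp: jcir_process_def)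
  have fin_H: "AE \<omega> in P. \<forall>T\<ge>0. (\<integral>\<^sup>+s\<in>{0..T}. ennreal ((H s \<omega>)\<^sup>2) \<partial>lborel) < \<infinity>"
    using I by (simp add: has_ito_integral_def)
  have sq: "AE \<omega> in P. \<forall>r\<ge>0. X r \<omega> = (H r \<omega>)\<^sup>2"
    using H nonneg by eventually_elim auto
  have Xm[measurable]: "X r \<in> borel_measurable P" if "0 \<le> r" for r
    using X that by (intro F_to_P) (auto simp: jcir_process_def adapted_def)
  have Jm[measurable]: "J r \<in> borel_measurable P" if "0 \<le> r" for r
    using J that by (intro F_to_P) (auto simp: pure_jump_levy_process_def adapted_def)
  have Im[measurable]: "I r \<in> borel_measurable P" if "0 \<le> r" for r
    using I that by (auto simp: has_ito_integral_def)
  define q where "q \<omega> = (\<integral>\<^sup>+r\<in>{s..t}. ennreal ((H r \<omega>)\<^sup>2) \<partial>lborel)" for \<omega>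
  have Hsq: "(\<lambda>(r, \<omega>). ennreal ((H r \<omega>)\<^sup>2) * indicator {s..t} r) \<in> borel_measurable (lborel \<Otimes>\<^sub>M P)"
    using I st by (intro progressively_measurable_sq[OF P]) (auto simp: has_ito_integral_def)
  have qm[measurable]: "q \<in> borel_measurable P"
    using lborel.borel_measurable_nn_integral[of "\<lambda>\<omega> r. ennreal ((H r \<omega>)\<^sup>2) * indicator {s..t} r" P]
      measurable_pair_swap[OF Hsq] unfolding q_def by (simp add: case_prod_beta)
  have Eq: "(\<integral>\<^sup>+\<omega>. q \<omega> \<partial>P) = (\<integral>\<^sup>+r\<in>{s..t}. f r \<partial>lborel)"
  proof -
    have "(\<integral>\<^sup>+\<omega>. q \<omega> \<partial>P) = (\<integral>\<^sup>+r. \<integral>\<^sup>+\<omega>. ennreal ((H r \<omega>)\<^sup>2) * indicator {s..t} r \<partial>P \<partial>lborel)"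
      unfolding q_def by (rule Fubini'[OF Hsq])
    also have "\<dots> = (\<integral>\<^sup>+r\<in>{s..t}. f r \<partial>lborel)"
    proof (rule nn_integral_cong)
      fix r
      show "(\<integral>\<^sup>+\<omega>. ennreal ((H r \<omega>)\<^sup>2) * indicator {s..t} r \<partial>P) = f r * indicator {s..t} r"
      proof (cases "r \<in> {s..t}")
        case True
        then have "0 \<le> r" using st by simp
        have "(\<integral>\<^sup>+\<omega>. ennreal ((H r \<omega>)\<^sup>2) \<partial>P) = f r"
          unfolding f_def using sq by (intro nn_integral_cong_AE) (auto elim!: eventually_mono simp: \<open>0 \<le> r\<close>)
        with True show ?thesis by simp
      qed simp
    qed
    finally show ?thesis .
  qed
  define E where "E \<omega> = ennreal (exp (l * (I t \<omega> - I s \<omega>) - l\<^sup>2 * enn2real (q \<omega>)))" for \<omega>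
  have Em[measurable]: "E \<in> borel_measurable P"
  proof -
    have [measurable]: "I t \<in> borel_measurable P" "I s \<in> borel_measurable P" using st by auto
    show ?thesis unfolding E_def by measurable
  qed
  have EE: "(\<integral>\<^sup>+\<omega>. E \<omega> \<partial>P) \<le> 1"
    unfolding E_def q_def by (rule nn_integral_exp_ito_integral_le[OF P W I st])
  define d where "d \<omega> = J t \<omega> - J s \<omega>" for \<omega>
  have dm[measurable]: "d \<in> borel_measurable P" unfolding d_def using st by auto
  have d: "AE \<omega> in P. 0 \<le> d \<omega>" "(\<integral>\<^sup>+\<omega>. ennreal (d \<omega>) \<partial>P) \<le> ennreal ((t - s) * m)"
    unfolding d_def m_def using levy_increment_nonneg_mean[OF P \<nu> J fin st] by auto
  have Xt[measurable]: "X t \<in> borel_measurable P" "X s \<in> borel_measurable P" using st by auto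
  have path: "AE \<omega> in P. ennreal (X t \<omega>) + ennreal b * q \<omega> + ennreal (\<sigma> / l)
       \<le> ennreal (\<sigma> / l) * E \<omega> + ennreal (X s \<omega>) + ennreal (a * \<theta> * (t - s)) + ennreal (d \<omega>)"
    using sde nonneg drift fin_H sq d(1)
  proof eventually_elim
    case (elim \<omega>)
    have "q \<omega> \<le> (\<integral>\<^sup>+r\<in>{0..t}. ennreal ((H r \<omega>)\<^sup>2) \<partial>lborel)"
      unfolding q_def using st by (intro nn_integral_mono) (auto simp: indicator_def)
    also have "\<dots> < \<infinity>" using elim(4) st by simp
    finally have "q \<omega> < \<infinity>" .
    then obtain y where y: "q \<omega> = ennreal y" "0 \<le> y" by (cases "q \<omega>") auto
    have "(LBINT r:{0..t}. a * (\<theta> - X r \<omega>)) - (LBINT r:{0..s}. a * (\<theta> - X r \<omega>)) = a * \<theta> * (t - s) - a * enn2real (q \<omega>)"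
      unfolding q_def using elim(3,5) st b by (intro affine_drift_increment) auto
    moreover have "X t \<omega> = x + (LBINT r:{0..t}. a * (\<theta> - X r \<omega>)) + \<sigma> * I t \<omega> + J t \<omega>"
      "X s \<omega> = x + (LBINT r:{0..s}. a * (\<theta> - X r \<omega>)) + \<sigma> * I s \<omega> + J s \<omega>"
      using elim(1) st by auto
    ultimately have incr: "\<sigma> * (I t \<omega> - I s \<omega>) = X t \<omega> - X s \<omega> + a * y - a * \<theta> * (t - s) - d \<omega>"
      using y by (simp add: d_def algebra_simps)
    define Z where "Z = exp (l * (I t \<omega> - I s \<omega>) - l\<^sup>2 * y)"
    have EZ: "E \<omega> = ennreal Z" "0 \<le> Z" using y by (simp_all add: E_def Z_def)
    have "1 + (l * (I t \<omega> - I s \<omega>) - l\<^sup>2 * y) \<le> Z"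
      unfolding Z_def by (rule exp_ge_add_one_self)
    then have "\<sigma> / l * (1 + (l * (I t \<omega> - I s \<omega>) - l\<^sup>2 * y)) \<le> \<sigma> / l * Z"
      using \<open>0 < \<sigma>\<close> l by (intro mult_left_mono) auto
    moreover have "\<sigma> / l * (1 + (l * (I t \<omega> - I s \<omega>) - l\<^sup>2 * y)) = \<sigma> / l + \<sigma> * (I t \<omega> - I s \<omega>) - \<sigma> * l * y"
      using l by (simp add: field_simps power2_eq_square)
    moreover have "a * y - \<sigma> * l * y = b * y" using l(2) by (simp add: algebra_simps flip: l(2))
    ultimately have le: "X t \<omega> + b * y + \<sigma> / l \<le> \<sigma> / l * Z + X s \<omega> + a * \<theta> * (t - s) + d \<omega>"
      using incr by linarith
    have pos: "0 \<le> X t \<omega>" "0 \<le> X s \<omega>" "0 \<le> a * \<theta> * (t - s)" "0 \<le> \<sigma> / l"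
      using elim(2) st \<open>0 \<le> \<theta>\<close> b l \<open>0 < \<sigma>\<close> by auto
    have "ennreal (X t \<omega>) + ennreal b * q \<omega> + ennreal (\<sigma> / l) = ennreal (X t \<omega> + b * y + \<sigma> / l)"
      unfolding y(1) using pos y(2) b by (simp add: ennreal_plus ennreal_mult)
    also have "\<dots> \<le> ennreal (\<sigma> / l * Z + X s \<omega> + a * \<theta> * (t - s) + d \<omega>)"
      by (rule ennreal_leI[OF le])
    also have "\<dots> = ennreal (\<sigma> / l * Z) + ennreal (X s \<omega>) + ennreal (a * \<theta> * (t - s)) + ennreal (d \<omega>)"
      using pos EZ(2) elim(6) mult_nonneg_nonneg[OF pos(4) EZ(2)] by (simp only: ennreal_plus add_nonneg_nonneg)
    also have "ennreal (\<sigma> / l * Z) = ennreal (\<sigma> / l) * E \<omega>"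
      unfolding EZ(1) by (rule ennreal_mult[OF pos(4) EZ(2)])
    finally show ?case .
  qed
  have "f t + ennreal b * (\<integral>\<^sup>+\<omega>. q \<omega> \<partial>P) + ennreal (\<sigma> / l)
      = (\<integral>\<^sup>+\<omega>. ennreal (X t \<omega>) + ennreal b * q \<omega> + ennreal (\<sigma> / l) \<partial>P)"
    unfolding f_def by (simp add: nn_integral_add nn_integral_cmult emeasure_space_1)
  also have "\<dots> \<le> (\<integral>\<^sup>+\<omega>. ennreal (\<sigma> / l) * E \<omega> + ennreal (X s \<omega>) + ennreal (a * \<theta> * (t - s)) + ennreal (d \<omega>) \<partial>P)"
    by (rule nn_integral_mono_AE[OF path])
  also have "\<dots> = ennreal (\<sigma> / l) * (\<integral>\<^sup>+\<omega>. E \<omega> \<partial>P) + f s + ennreal (a * \<theta> * (t - s)) + (\<integral>\<^sup>+\<omega>. ennreal (d \<omega>) \<partial>P)"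
    unfolding f_def by (simp add: nn_integral_add nn_integral_cmult emeasure_space_1)
  also have "\<dots> \<le> ennreal (\<sigma> / l) * 1 + f s + ennreal (a * \<theta> * (t - s)) + ennreal ((t - s) * m)"
    using d(2) EE by (intro add_mono mult_left_mono) auto
  also have "\<dots> = (f s + ennreal (c * (t - s))) + ennreal (\<sigma> / l)"
  proof -
    have "ennreal (c * (t - s)) = ennreal (a * \<theta> * (t - s)) + ennreal ((t - s) * m)"
    proof -
      have "0 \<le> a * \<theta> * (t - s)" "0 \<le> (t - s) * m"
        using st b \<open>0 \<le> \<theta>\<close> by (simp_all add: m_def)
      moreover have "c * (t - s) = a * \<theta> * (t - s) + (t - s) * m"
        by (simp add: c_def m_def algebra_simps)
      ultimately show ?thesis by (simp only: ennreal_plus)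
    qed
    then show ?thesis by (simp add: ac_simps)
  qed
  finally show ?thesis
    unfolding Eq by (simp add: ennreal_add_left_cancel_le add.commute[of _ "ennreal (\<sigma> / l)"])
qed

text \<open>
  The hypothesis is a step of the implicit Euler scheme for \<open>g' = c - b g\<close>, up to a term of order
  \<open>\<delta>\<^sup>2\<close>. Subtracting its fixed point \<open>c / b * (1 + b \<delta>)\<close> leaves a contraction by \<open>1 / (1 + b \<delta>)\<close>; \<open>n\<close> steps of
  size \<open>t / n\<close> contract by \<open>(1 + b t / n) ^ - n\<close>, which tends to \<open>exp (- b t)\<close>. A discrete
  form of Gronwall's lemma suits the mean of \<open>X\<close>, whose continuity in time is unclear.
\<close>

lemma implicit_euler_gronwall:
  fixes g :: "real \<Rightarrow> real"
  assumes "0 < b" "0 \<le> c" "0 < t"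
    and step: "\<And>s \<delta>. 0 \<le> s \<Longrightarrow> 0 < \<delta> \<Longrightarrow> g (s + \<delta>) * (1 + b * \<delta>) \<le> g s + c * \<delta> * (1 + b * \<delta>)"
  shows "g t \<le> exp (- b * t) * g 0 + c / b"
proof -
  have iter: "g (real n * \<delta>) - c / b * (1 + b * \<delta>) \<le> (g 0 - c / b * (1 + b * \<delta>)) / (1 + b * \<delta>) ^ n"
    if "0 < \<delta>" for \<delta> n
  proof (induction n)
    case (Suc n)
    define k y where "k = 1 + b * \<delta>" and "y = c / b * k"
    have k: "0 < k" using \<open>0 < b\<close> that by (simp add: k_def add_pos_pos)
    have "g (real n * \<delta> + \<delta>) * k \<le> g (real n * \<delta>) + c * \<delta> * k"
      using step[of "real n * \<delta>" \<delta>] that by (simp add: k_def)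
    moreover have "y * k = y + c * \<delta> * k" using \<open>0 < b\<close> by (simp add: y_def k_def field_simps)
    ultimately have "(g (real n * \<delta> + \<delta>) - y) * k \<le> g (real n * \<delta>) - y" by (simp add: algebra_simps)
    also have "\<dots> \<le> (g 0 - y) / k ^ n" using Suc by (simp add: y_def k_def)
    finally have "g (real n * \<delta> + \<delta>) - y \<le> (g 0 - y) / k ^ n / k" by (simp only: pos_le_divide_eq[OF k])
    then show ?case by (simp add: y_def k_def algebra_simps)
  qed simp
  have "(\<lambda>n. c / b * (1 + b * (t / real n)) + (g 0 - c / b * (1 + b * (t / real n))) / (1 + (b * t) / real n) ^ n)
      \<longlonglongrightarrow> c / b * (1 + b * 0) + (g 0 - c / b * (1 + b * 0)) / exp (b * t)"
    by (intro tendsto_intros tendsto_exp_limit_sequentially lim_const_over_n) auto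
  then have "g t \<le> c / b * (1 + b * 0) + (g 0 - c / b * (1 + b * 0)) / exp (b * t)"
  proof (rule LIMSEQ_le_const, intro exI[of _ 1] allI impI)
    fix n :: nat assume "1 \<le> n"
    then show "g t \<le> c / b * (1 + b * (t / real n)) + (g 0 - c / b * (1 + b * (t / real n))) / (1 + (b * t) / real n) ^ n"
      using iter[of "t / real n" n] \<open>0 < t\<close> by simp
  qed
  also have "\<dots> = exp (- b * t) * g 0 + c / b - c / b * exp (- b * t)"
    by (simp add: exp_minus field_simps)
  also have "\<dots> \<le> exp (- b * t) * g 0 + c / b"
    using assms by simp
  finally show ?thesis .
qed

text \<open>
  The mean \<open>f\<close> grows at most linearly, with slope \<open>c\<close>. On a step of length \<open>\<delta>\<close> it therefore stays above
  its final value minus \<open>c \<delta>\<close>, and bounding \<open>\<integral> f\<close> from below in this way turns the integral inequality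
  into an implicit Euler step.
\<close>

lemma jcir_mean_bound:
  fixes X :: "real \<Rightarrow> 'w \<Rightarrow> real"
  assumes "0 < a" and "0 < \<sigma>" and "0 \<le> \<theta>" and P: "filtered_prob_space P F"
    and \<nu>: "positive_levy_measure \<nu>" and W: "brownian_motion P F W"
    and J: "pure_jump_levy_process P F \<nu> J"
    and X: "jcir_process P F W J a \<theta> \<sigma> x X"
    and fin: "(\<integral>\<^sup>+\<xi>\<in>{0<..}. ennreal \<xi> \<partial>\<nu>) < \<infinity>" and "0 \<le> x" and "0 < t"
  defines "c \<equiv> a * \<theta> + enn2real (\<integral>\<^sup>+\<xi>\<in>{0<..}. ennreal \<xi> \<partial>\<nu>)"
  shows "(\<integral>\<^sup>+\<omega>. ennreal (X t \<omega>) \<partial>P) \<le> ennreal (exp (- a * t) * x + c / a)"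
proof -
  interpret prob_space P using P by (simp add: filtered_prob_space_def)
  define f where "f = (\<lambda>r. \<integral>\<^sup>+\<omega>. ennreal (X r \<omega>) \<partial>P)"
  define g where "g r = enn2real (f r)" for r
  have c: "0 \<le> c" using assms by (simp add: c_def)
  have main: "f t + ennreal b * (\<integral>\<^sup>+r\<in>{s..t}. f r \<partial>lborel) \<le> f s + ennreal (c * (t - s))"
    if "0 \<le> s" "s < t" "0 < b" "b < a" for s t b
    unfolding f_def c_def
    using jcir_mean_step[OF \<open>0 < \<sigma>\<close> \<open>0 \<le> \<theta>\<close> P \<nu> W J X fin that] .
  have mono: "f t \<le> f s + ennreal (c * (t - s))" if "0 \<le> s" "s \<le> t" for s t
  proof (cases "s = t")
    case False
    have "f t \<le> f t + ennreal (a / 2) * (\<integral>\<^sup>+r\<in>{s..t}. f r \<partial>lborel)" by simp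
    also have "\<dots> \<le> f s + ennreal (c * (t - s))"
      using that False \<open>0 < a\<close> by (intro main) auto
    finally show ?thesis .
  qed simp
  have "AE \<omega> in P. X 0 \<omega> = x" using X by (simp add: jcir_process_def)
  then have "f 0 = (\<integral>\<^sup>+\<omega>. ennreal x \<partial>P)"
    unfolding f_def by (intro nn_integral_cong_AE) (auto elim: eventually_mono)
  then have f0: "f 0 = ennreal x" by (simp add: emeasure_space_1)
  have fg: "f r = ennreal (g r)" if "0 \<le> r" for r
  proof -
    have "f r < \<infinity>" using mono[of 0 r] that f0 by (simp add: ennreal_plus[symmetric] order_le_less_trans del: ennreal_plus)
    then show ?thesis by (simp add: g_def)
  qed
  have g0: "g 0 = x" using f0 \<open>0 \<le> x\<close> by (simp add: g_def)
  have gpos: "0 \<le> g r" for r by (simp add: g_def)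
  have gb: "g t \<le> exp (- b * t) * x + c / b" if b: "0 < b" "b < a" for b
    unfolding g0[symmetric]
  proof (rule implicit_euler_gronwall[OF b(1) c \<open>0 < t\<close>])
    fix s \<delta> :: real assume s: "0 \<le> s" "0 < \<delta>"
    \<comment> \<open>If the difference is negative, \<open>ennreal\<close> maps it to 0 and the bound is trivial.\<close>
    have low: "ennreal (g (s + \<delta>) - c * \<delta>) \<le> f r" if "r \<in> {s..s + \<delta>}" for r
    proof -
      have "f (s + \<delta>) \<le> f r + ennreal (c * (s + \<delta> - r))"
        using that s by (intro mono) auto
      then have "g (s + \<delta>) \<le> g r + c * (s + \<delta> - r)"
        using that s c gpos by (simp add: fg ennreal_plus[symmetric] del: ennreal_plus)
      also have "\<dots> \<le> g r + c * \<delta>"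
        using that c by (intro add_left_mono mult_left_mono) auto
      finally show ?thesis using that s by (simp add: fg ennreal_leI)
    qed
    have "ennreal (g (s + \<delta>)) + ennreal b * (ennreal (g (s + \<delta>) - c * \<delta>) * ennreal \<delta>)
        = f (s + \<delta>) + ennreal b * (\<integral>\<^sup>+r. ennreal (g (s + \<delta>) - c * \<delta>) * indicator {s..s + \<delta>} r \<partial>lborel)"
      using s by (simp add: fg nn_integral_cmult_indicator)
    also have "\<dots> \<le> f (s + \<delta>) + ennreal b * (\<integral>\<^sup>+r\<in>{s..s + \<delta>}. f r \<partial>lborel)"
      using low by (intro add_left_mono mult_left_mono nn_integral_mono) (auto simp: indicator_def)
    also have "\<dots> \<le> f s + ennreal (c * \<delta>)"
      using main[of s "s + \<delta>" b] s b by simp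
    also have "\<dots> = ennreal (g s + c * \<delta>)"
      using s c gpos by (simp add: fg ennreal_plus)
    finally have *: "ennreal (g (s + \<delta>)) + ennreal b * (ennreal (g (s + \<delta>) - c * \<delta>) * ennreal \<delta>) \<le> ennreal (g s + c * \<delta>)" .
    show "g (s + \<delta>) * (1 + b * \<delta>) \<le> g s + c * \<delta> * (1 + b * \<delta>)"
    proof (cases "0 \<le> g (s + \<delta>) - c * \<delta>")
      case True
      have "g (s + \<delta>) + b * ((g (s + \<delta>) - c * \<delta>) * \<delta>) \<le> g s + c * \<delta>"
        using * True b s c gpos
        by (simp add: ennreal_mult[symmetric] ennreal_plus[symmetric] del: ennreal_plus)
      then show ?thesis by (simp add: algebra_simps)
    next
      case False
      then have "g (s + \<delta>) * (1 + b * \<delta>) \<le> c * \<delta> * (1 + b * \<delta>)"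
        using b s by (intro mult_right_mono) auto
      then show ?thesis using gpos[of s] by linarith
    qed
  qed
  \<comment> \<open>The rate \<open>a\<close> itself is recovered as the limit of the rates \<open>b < a\<close>.\<close>
  have "((\<lambda>b. exp (- b * t) * x + c / b) \<longlongrightarrow> exp (- a * t) * x + c / a) (at_left a)"
    using \<open>0 < a\<close> by (intro tendsto_intros) auto
  then have "g t \<le> exp (- a * t) * x + c / a"
    by (rule tendsto_lowerbound)
       (use eventually_at_left_real[OF \<open>0 < a\<close>] gb in \<open>auto elim!: eventually_mono\<close>)
  then show ?thesis using fg[of t] \<open>0 < t\<close> by (simp add: f_def ennreal_leI)
qed

theorem lemma4p1:
  fixes P :: "'w measure" and F :: "real \<Rightarrow> 'w measure"
    and W J :: "real \<Rightarrow> 'w \<Rightarrow> real"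
    and X :: "real \<Rightarrow> real \<Rightarrow> 'w \<Rightarrow> real"
    and \<nu> :: "real measure" and a \<theta> \<sigma> :: real
  assumes "0 < a" and "0 < \<sigma>" and "0 \<le> \<theta>"
    and "filtered_prob_space P F"
    and "positive_levy_measure \<nu>"
    and "brownian_motion P F W"
    and "pure_jump_levy_process P F \<nu> J"
    and "independent_processes P W J"
    and "\<And>x. 0 \<le> x \<Longrightarrow> jcir_process P F W J a \<theta> \<sigma> x (X x)"
    and "(\<integral>\<^sup>+\<xi>\<in>{1<..}. ennreal \<xi> \<partial>\<nu>) < \<infinity>"
  shows "forster_lyapunov P X a (\<lambda>x. x)"
proof -
  interpret filtration "space P" F using assms(4) by (simp add: filtered_prob_space_def)
  have fin: "(\<integral>\<^sup>+\<xi>\<in>{0<..}. ennreal \<xi> \<partial>\<nu>) < \<infinity>"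
    by (rule levy_measure_mean_finite) fact+
  define c where "c = a * \<theta> + enn2real (\<integral>\<^sup>+\<xi>\<in>{0<..}. ennreal \<xi> \<partial>\<nu>)"
  have "0 \<le> c" using assms by (simp add: c_def)
  have mean: "integrable P (X x t) \<and> (\<integral>\<omega>. X x t \<omega> \<partial>P) \<le> exp (- a * t) * x + (c / a + 1)"
    if "0 < t" "0 \<le> x" for t x
  proof -
    have X: "jcir_process P F W J a \<theta> \<sigma> x (X x)" by (rule assms(9)) fact
    have bound: "(\<integral>\<^sup>+\<omega>. ennreal (X x t \<omega>) \<partial>P) \<le> ennreal (exp (- a * t) * x + c / a)"
      unfolding c_def by (rule jcir_mean_bound[OF assms(1-7) X fin that(2,1)])
    have "X x t \<in> borel_measurable (F t)"
      using X that by (auto simp: jcir_process_def adapted_def)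
    then have meas: "X x t \<in> borel_measurable P"
      using measurable_mono[of borel borel "F t" P] assms(4) by (auto simp: space_F filtered_prob_space_def)
    have "AE \<omega> in P. \<forall>t\<ge>0. 0 \<le> X x t \<omega>" using X by (simp add: jcir_process_def)
    then have nonneg: "AE \<omega> in P. 0 \<le> X x t \<omega>" by eventually_elim (use that in simp)
    have int: "integrable P (X x t)"
      using meas nonneg order_le_less_trans[OF bound ennreal_less_top] by (intro integrableI_nonneg) auto
    have "0 \<le> exp (- a * t) * x + c / a" using that \<open>0 \<le> c\<close> \<open>0 < a\<close> by simp
    then have "(\<integral>\<omega>. X x t \<omega> \<partial>P) \<le> exp (- a * t) * x + c / a"
      using bound nn_integral_eq_integral[OF int nonneg] by simp
    with int show ?thesis by simp
  qed
  show ?thesis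
    unfolding forster_lyapunov_def
    using mean \<open>0 \<le> c\<close> \<open>0 < a\<close> by (intro exI[of _ "c / a + 1"]) (auto simp: add_nonneg_pos)
qed

end
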